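(* Let $R$ be the Kazhdan-Lusztig semiring of $S_3$, i.e. the $\mathbb{Z}_{\geq 0}$-span of the Kazhdan-Lusztig basis $\{\underline{w}:w\in S_3\}$ in $\mathbb{Z}[S_3]$. Then, up to isomorphism, the $R$-semimodules $M_1$, $M_2$, $M_3$, $M_7$, $M_8$ and $M_9$ (defined in the context) are the only elementary proper $R$-semimodules.
   Context: A semiring is a tuple $(R,+,\cdot,0,1)$ where $(R,+,0)$ is a commutative monoid, $(R,\cdot,1)$ is a monoid, multiplication distributes over addition on both sides, and $0a=a0=0$ for all $a\in R$. A (left) $R$-semimodule is a commutative monoid $(M,+,0_M)$ with a map $R\times M\to M$, $(r,m)\mapsto r(m)$, such that $r(m+n)=r(m)+r(n)$, $r(0_M)=0_M$, $(r+s)(m)=r(m)+s(m)$, $(rs)(m)=r(s(m))$, $0(m)=0_M$, $1(m)=m$. It is called an $R$-module if $M$ is an abelian group, and a proper semimodule if it is not a module. A subsemimodule is a submonoid closed under the action of $R$. An $R$-congruence on $M$ is an equivalence relation $\sim$ such that $m\sim n$ implies $m+k\sim n+k$ for all $k\in M$ and $r(m)\sim r(n)$ for all $r\in R$. A non-zero $R$-semimodule $M$ is called elementary if its only $R$-congruences are the equality relation and the full relation $M\times M$. Let $s=(1,2)$, $t=(2,3)$ in $S_3=\{e,s,t,st,ts,w_0=sts=tst\}$. The Kazhdan-Lusztig basis of $\mathbb{Z}[S_3]$ is $\underline{e}=e$, $\underline{s}=e+s$, $\underline{t}=e+t$, $\underline{st}=e+s+t+st$, $\underline{ts}=e+s+t+ts$,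 $\underline{w_0}=e+s+t+st+ts+w_0$. Its structure constants are non-negative integers, so $R$ (the set of all $\mathbb{Z}_{\geq 0}$-linear combinations of these elements) is a subsemiring of $\mathbb{Z}[S_3]$. Let $\mathbf{B}$ denote the commutative monoid $(\{0,1\},+,0)$ with $1+1=1$. Define: - $M_1$: underlying monoid $\mathbf{B}$, all $\underline{w}$, $w\in S_3$, act as the identity. - $M_2$: underlying monoid $\mathbf{B}$, $\underline{e}$ acts as the identity and all $\underline{w}$ with $w\neq e$ act as zero. - $M_3$: underlying monoid $\mathbf{B}$, all $\underline{w}$ with $w\neq w_0$ act as the identity and $\underline{w_0}$ acts as zero. - $M_7$: underlying monoid $\mathbf{B}\oplus\mathbf{B}$ (componentwise addition); $\underline{e}$ acts as the identity; $\underline{w_0}$ acts as zero; $\underline{s}$ and $\underline{ts}$ both act by $(0,0)\mapsto(0,0)$, $(0,1)\mapsto(0,0)$, $(1,0)\mapsto(1,1)$, $(1,1)\mapsto(1,1)$; $\underline{t}$ and $\underline{st}$ both act by $(0,0)\mapsto(0,0)$, $(0,1)\mapsto(1,1)$, $(1,0)\mapsto(0,0)$, $(1,1)\mapsto(1,1)$. - $M_8$: the subsemimodule $\{(0,0),(1,0),(1,1)\}$ of $M_7$. - $M_9$: the subsemimodule $\{(0,0),(0,1),(1,1)\}$ of $M_7$. *)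

theory Defs
  imports "HOL-Algebra.Sym_Groups" "HOL-Algebra.Module"
begin

section \<open>Semimodules over a semiring\<close>

text \<open>
  The library locale \<^locale>\<open>module\<close> asks for a commutative ring and an abelian group. The record
  \<^type>\<open>module\<close> is reused here for semimodules; its multiplicative fields play no role.
\<close>

locale semimodule = R?: semiring R + M?: abelian_monoid M
  for R (structure) and M :: "('a, 'b, 'm) module_scheme" (structure) +
  assumes smult_closed [simp, intro]:
      "\<lbrakk>r \<in> carrier R; x \<in> carrier M\<rbrakk> \<Longrightarrow> r \<odot>\<^bsub>M\<^esub> x \<in> carrier M"
    and smult_r_distr:
      "\<lbrakk>r \<in> carrier R; x \<in> carrier M; y \<in> carrier M\<rbrakk> \<Longrightarrow>
       r \<odot>\<^bsub>M\<^esub> (x \<oplus>\<^bsub>M\<^esub> y) = r \<odot>\<^bsub>M\<^esub> x \<oplus>\<^bsub>M\<^esub> r \<odot>\<^bsub>M\<^esub> y"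
    and smult_r_null: "r \<in> carrier R \<Longrightarrow> r \<odot>\<^bsub>M\<^esub> \<zero>\<^bsub>M\<^esub> = \<zero>\<^bsub>M\<^esub>"
    and smult_l_distr:
      "\<lbrakk>r \<in> carrier R; q \<in> carrier R; x \<in> carrier M\<rbrakk> \<Longrightarrow>
       (r \<oplus>\<^bsub>R\<^esub> q) \<odot>\<^bsub>M\<^esub> x = r \<odot>\<^bsub>M\<^esub> x \<oplus>\<^bsub>M\<^esub> q \<odot>\<^bsub>M\<^esub> x"
    and smult_assoc:
      "\<lbrakk>r \<in> carrier R; q \<in> carrier R; x \<in> carrier M\<rbrakk> \<Longrightarrow>
       (r \<otimes>\<^bsub>R\<^esub> q) \<odot>\<^bsub>M\<^esub> x = r \<odot>\<^bsub>M\<^esub> (q \<odot>\<^bsub>M\<^esub> x)"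
    and smult_l_null: "x \<in> carrier M \<Longrightarrow> \<zero>\<^bsub>R\<^esub> \<odot>\<^bsub>M\<^esub> x = \<zero>\<^bsub>M\<^esub>"
    and smult_one: "x \<in> carrier M \<Longrightarrow> \<one>\<^bsub>R\<^esub> \<odot>\<^bsub>M\<^esub> x = x"

definition proper_semimodule :: "('a, 'r) ring_scheme \<Rightarrow> ('a, 'b, 'm) module_scheme \<Rightarrow> bool"
  where "proper_semimodule R M \<longleftrightarrow> semimodule R M \<and> \<not> abelian_group M"

definition semimodule_congruence ::
    "('a, 'r) ring_scheme \<Rightarrow> ('a, 'b, 'm) module_scheme \<Rightarrow> ('b \<times> 'b) set \<Rightarrow> bool"
  where "semimodule_congruence R M \<rho> \<longleftrightarrow>
    equiv (carrier M) \<rho> \<and>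
    (\<forall>(m, n) \<in> \<rho>. (\<forall>k \<in> carrier M. (m \<oplus>\<^bsub>M\<^esub> k, n \<oplus>\<^bsub>M\<^esub> k) \<in> \<rho>) \<and>
                  (\<forall>r \<in> carrier R. (r \<odot>\<^bsub>M\<^esub> m, r \<odot>\<^bsub>M\<^esub> n) \<in> \<rho>))"

definition elementary_semimodule :: "('a, 'r) ring_scheme \<Rightarrow> ('a, 'b, 'm) module_scheme \<Rightarrow> bool"
  where "elementary_semimodule R M \<longleftrightarrow>
    semimodule R M \<and> carrier M \<noteq> {\<zero>\<^bsub>M\<^esub>} \<and>
    (\<forall>\<rho>. semimodule_congruence R M \<rho> \<longrightarrow> \<rho> = Id_on (carrier M) \<or> \<rho> = carrier M \<times> carrier M)"

definition semimodule_iso ::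
    "('a, 'r) ring_scheme \<Rightarrow> ('a, 'b, 'm) module_scheme \<Rightarrow> ('a, 'c, 'n) module_scheme \<Rightarrow> ('b \<Rightarrow> 'c) set"
  where "semimodule_iso R M N =
    {h \<in> iso (add_monoid M) (add_monoid N).
       h \<zero>\<^bsub>M\<^esub> = \<zero>\<^bsub>N\<^esub> \<and> (\<forall>r \<in> carrier R. \<forall>x \<in> carrier M. h (r \<odot>\<^bsub>M\<^esub> x) = r \<odot>\<^bsub>N\<^esub> h x)}"

definition isomorphic_semimodules ::
    "('a, 'r) ring_scheme \<Rightarrow> ('a, 'b, 'm) module_scheme \<Rightarrow> ('a, 'c, 'n) module_scheme \<Rightarrow> bool"
  where "isomorphic_semimodules R M N \<longleftrightarrow> semimodule_iso R M N \<noteq> {}"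


section \<open>The Kazhdan-Lusztig semiring of the symmetric group on three letters\<close>

text \<open>
  The integral group ring of a finite group: a formal combination is the function giving the
  coefficient of each group element, extended by zero outside the carrier.
\<close>

definition int_group_ring :: "('g, 'm) monoid_scheme \<Rightarrow> ('g \<Rightarrow> int) ring"
  where "int_group_ring G =
    \<lparr>carrier = {f. \<forall>x. x \<notin> carrier G \<longrightarrow> f x = 0},
     mult = (\<lambda>f g x. \<Sum>(y, z) \<in> {(y, z). y \<in> carrier G \<and> z \<in> carrier G \<and> y \<otimes>\<^bsub>G\<^esub> z = x}. f y * g z),
     one = (\<lambda>x. if x = \<one>\<^bsub>G\<^esub> then 1 else 0),
     zero = (\<lambda>x. 0),
     add = (\<lambda>f g x. f x + g x)\<rparr>"

abbreviation S3 :: "(nat \<Rightarrow> nat) monoid"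
  where "S3 \<equiv> sym_group 3"

abbreviation S3_s :: "nat \<Rightarrow> nat" where "S3_s \<equiv> Transposition.transpose 1 2"
abbreviation S3_t :: "nat \<Rightarrow> nat" where "S3_t \<equiv> Transposition.transpose 2 3"

definition S3_w0 :: "nat \<Rightarrow> nat"
  where "S3_w0 = S3_s \<circ> S3_t \<circ> S3_s"

text \<open>The set of group elements occurring (with coefficient one) in the basis element of \<open>w\<close>.\<close>

definition kl_support :: "(nat \<Rightarrow> nat) \<Rightarrow> (nat \<Rightarrow> nat) set"
  where "kl_support w =
    (if w = id then {id}
     else if w = S3_s then {id, S3_s}
     else if w = S3_t then {id, S3_t}
     else if w = S3_s \<circ> S3_t then {id, S3_s, S3_t, S3_s \<circ> S3_t}
     else if w = S3_t \<circ> S3_s then {id, S3_s, S3_t, S3_t \<circ> S3_s}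
     else {id, S3_s, S3_t, S3_s \<circ> S3_t, S3_t \<circ> S3_s, S3_w0})"

definition kl_basis :: "(nat \<Rightarrow> nat) \<Rightarrow> (nat \<Rightarrow> nat) \<Rightarrow> int"
  where "kl_basis w = (\<lambda>x. if x \<in> kl_support w then 1 else 0)"

text \<open>
  \<open>nat_comb A c v\<close> is the sum of the \<open>c w\<close>-fold multiples of the elements \<open>v w\<close> in the
  commutative monoid \<open>A\<close>, over all \<open>w\<close> in \<open>S3\<close>.
\<close>

definition nat_comb ::
    "('b, 'm) ring_scheme \<Rightarrow> ((nat \<Rightarrow> nat) \<Rightarrow> nat) \<Rightarrow> ((nat \<Rightarrow> nat) \<Rightarrow> 'b) \<Rightarrow> 'b"
  where "nat_comb A c v = (\<Oplus>\<^bsub>A\<^esub>w \<in> carrier S3. [c w] \<cdot>\<^bsub>A\<^esub> v w)"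

definition KL_S3 :: "((nat \<Rightarrow> nat) \<Rightarrow> int) ring"
  where "KL_S3 = (int_group_ring S3)
    \<lparr>carrier := {nat_comb (int_group_ring S3) c kl_basis | c. True}\<rparr>"


section \<open>The six semimodules\<close>

text \<open>
  Coefficients of an element of the semiring with respect to the Kazhdan-Lusztig basis. By linear
  independence of the basis, the values on \<open>S3\<close> do not depend on the choice.
\<close>

definition kl_coeff :: "((nat \<Rightarrow> nat) \<Rightarrow> int) \<Rightarrow> (nat \<Rightarrow> nat) \<Rightarrow> nat"
  where "kl_coeff r = (SOME c. r = nat_comb (int_group_ring S3) c kl_basis)"

text \<open>
  The commutative monoid \<open>A\<close>, with the basis element of \<open>w\<close> acting by \<open>act w\<close> and the action extended
  additively to the whole semiring.
\<close>

definition kl_semimodule ::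
    "'b ring \<Rightarrow> ((nat \<Rightarrow> nat) \<Rightarrow> 'b \<Rightarrow> 'b) \<Rightarrow> ((nat \<Rightarrow> nat) \<Rightarrow> int, 'b) module"
  where "kl_semimodule A act =
    \<lparr>carrier = carrier A, mult = mult A, one = one A, zero = zero A, add = add A,
     smult = (\<lambda>r m. nat_comb A (kl_coeff r) (\<lambda>w. act w m))\<rparr>"

text \<open>
  The monoid \<open>{0, 1}\<close> with \<open>1 + 1 = 1\<close>, as the type \<^typ>\<open>bool\<close> under disjunction (\<open>0\<close> is
  \<^term>\<open>False\<close>), and its square. Only the additive structure is meant.
\<close>

definition B_monoid :: "bool ring"
  where "B_monoid = \<lparr>carrier = UNIV, mult = undefined, one = undefined, zero = False, add = (\<or>)\<rparr>"

definition BB_monoid :: "(bool \<times> bool) ring"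
  where "BB_monoid = \<lparr>carrier = UNIV, mult = undefined, one = undefined, zero = (False, False),
    add = (\<lambda>(a, b) (c, d). (a \<or> c, b \<or> d))\<rparr>"

definition M1 :: "((nat \<Rightarrow> nat) \<Rightarrow> int, bool) module"
  where "M1 = kl_semimodule B_monoid (\<lambda>w x. x)"

definition M2 :: "((nat \<Rightarrow> nat) \<Rightarrow> int, bool) module"
  where "M2 = kl_semimodule B_monoid (\<lambda>w x. if w = id then x else False)"

definition M3 :: "((nat \<Rightarrow> nat) \<Rightarrow> int, bool) module"
  where "M3 = kl_semimodule B_monoid (\<lambda>w x. if w = S3_w0 then False else x)"

definition M7_act :: "(nat \<Rightarrow> nat) \<Rightarrow> bool \<times> bool \<Rightarrow> bool \<times> bool"
  where "M7_act w = (\<lambda>(a, b).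
    if w = id then (a, b)
    else if w = S3_s \<or> w = S3_t \<circ> S3_s then (a, a)
    else if w = S3_t \<or> w = S3_s \<circ> S3_t then (b, b)
    else (False, False))"

definition M7 :: "((nat \<Rightarrow> nat) \<Rightarrow> int, bool \<times> bool) module"
  where "M7 = kl_semimodule BB_monoid M7_act"

definition M8 :: "((nat \<Rightarrow> nat) \<Rightarrow> int, bool \<times> bool) module"
  where "M8 = M7\<lparr>carrier := {(False, False), (True, False), (True, True)}\<rparr>"

definition M9 :: "((nat \<Rightarrow> nat) \<Rightarrow> int, bool \<times> bool) module"
  where "M9 = M7\<lparr>carrier := {(False, False), (False, True), (True, True)}\<rparr>"

end

theory Submission
  imports Defs
begin

text \<open>
  Both halves of the classification rest on reducing everything to three operators: the semiring is
  generated by the basis elements of \<open>s\<close>, \<open>t\<close> and \<open>w0\<close> (induction rule \<open>KL_S3_induct\<close>), so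
  a semimodule is governed by three additive endomorphisms \<open>S\<close>, \<open>T\<close>, \<open>W\<close>, and congruences
  and isomorphisms only have to be tested on these. On an additively idempotent semimodule the
  multiplication table of the basis says that \<open>S\<close>, \<open>T\<close>, \<open>W\<close> are idempotent, that \<open>W\<close> absorbs
  \<open>S\<close> and \<open>T\<close> on both sides, and that \<open>STS = W + S\<close> and \<open>TST = W + T\<close>.

  Elementary semimodules are idempotent or groups: "each is bounded by a multiple of the other" is a
  congruence; if it is equality, then \<open>x\<close> and \<open>x + x\<close> coincide, and if it is full, then every
  element lies below zero and is invertible (\<open>elementary_group_or_idempotent\<close>).

  Let now \<open>M\<close> be elementary and idempotent. If the kernel of a map is a congruence, the map is
  injective or constant (\<open>elementary_kernel_dichotomy\<close>); this is used with four maps. Since \<open>W\<close>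
  commutes with the action, \<open>W\<close> is injective or zero. If it is injective, absorption forces
  \<open>S = T = W = id\<close>, and the predicate \<open>x = 0\<close> has a congruence as kernel, so \<open>M\<close> has two elements and is
  \<open>M1\<close>. If \<open>W = 0\<close>, consider the pair \<open>(S, T)\<close>. If it is constant, then \<open>S = T = 0\<close> and
  \<open>M\<close> is \<open>M2\<close> by the same two-element argument. If it is injective, then \<open>TS = S\<close> and
  \<open>ST = T\<close>, because \<open>S\<close> and \<open>T\<close> do not distinguish the two sides. Now
  \<open>x \<mapsto> (S x \<noteq> 0, T x \<noteq> 0)\<close> also has a congruence as kernel and is not constant, hence embeds \<open>M\<close> into
  \<open>M7\<close>. Its image contains the zero and the top element, which leaves \<open>M7\<close>, \<open>M8\<close>, \<open>M9\<close>, and the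
  two-element chain, which is \<open>M3\<close>.

  Conversely, the six examples are semimodules by a presentation criterion
  (\<open>semimodule_kl_semimodule\<close>), and they are elementary because a congruence other than equality
  identifies zero with the top element and then collapses everything
  (\<open>elementary_proper_if_absorbing\<close>).
\<close>

\<comment> \<open>Otherwise the simplifier rewrites the letter \<open>1\<close> inside the transposition \<open>s\<close> to a successor.\<close>
declare One_nat_def [simp del]

section \<open>The integral group ring\<close>

lemma int_group_ring_simps [simp]:
  "carrier (int_group_ring G) = {f. \<forall>x. x \<notin> carrier G \<longrightarrow> f x = 0}"
  "\<one>\<^bsub>int_group_ring G\<^esub> = (\<lambda>x. if x = \<one>\<^bsub>G\<^esub> then 1 else 0)"
  "\<zero>\<^bsub>int_group_ring G\<^esub> = (\<lambda>x. 0)"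
  "f \<oplus>\<^bsub>int_group_ring G\<^esub> g = (\<lambda>x. f x + g x)"
  by (simp_all add: int_group_ring_def)

lemma int_group_ring_mult:
  assumes "finite (carrier G)"
  shows "(f \<otimes>\<^bsub>int_group_ring G\<^esub> g) x =
    (\<Sum>y\<in>carrier G. \<Sum>z\<in>carrier G. if y \<otimes>\<^bsub>G\<^esub> z = x then f y * g z else 0)"
proof -
  let ?C = "carrier G \<times> carrier G"
  have "{(y, z). y \<in> carrier G \<and> z \<in> carrier G \<and> y \<otimes>\<^bsub>G\<^esub> z = x}
      = {p \<in> ?C. fst p \<otimes>\<^bsub>G\<^esub> snd p = x}"
    by auto
  then have "(f \<otimes>\<^bsub>int_group_ring G\<^esub> g) x
      = (\<Sum>p\<in>{p \<in> ?C. fst p \<otimes>\<^bsub>G\<^esub> snd p = x}. f (fst p) * g (snd p))"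
    by (simp add: int_group_ring_def case_prod_unfold)
  also have "\<dots> = (\<Sum>p\<in>?C. if fst p \<otimes>\<^bsub>G\<^esub> snd p = x then f (fst p) * g (snd p) else 0)"
    using assms by (intro sum.inter_filter) simp
  finally show ?thesis
    by (simp add: sum.cartesian_product case_prod_unfold)
qed

text \<open>
  In a group the second factor of \<open>y \<otimes> z = x\<close> is determined by the first, so one of the two sums collapses.
\<close>

lemma int_group_ring_mult_group:
  assumes "group G" "finite (carrier G)" "x \<in> carrier G"
  shows "(f \<otimes>\<^bsub>int_group_ring G\<^esub> g) x = (\<Sum>y\<in>carrier G. f y * g (inv\<^bsub>G\<^esub> y \<otimes>\<^bsub>G\<^esub> x))"
proof -
  interpret group G by fact
  have "(\<Sum>z\<in>carrier G. if y \<otimes>\<^bsub>G\<^esub> z = x then f y * g z else 0) = f y * g (inv\<^bsub>G\<^esub> y \<otimes>\<^bsub>G\<^esub> x)"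
    if "y \<in> carrier G" for y
  proof -
    have "(\<Sum>z\<in>carrier G. if y \<otimes>\<^bsub>G\<^esub> z = x then f y * g z else 0)
        = (\<Sum>z\<in>carrier G. if z = inv\<^bsub>G\<^esub> y \<otimes>\<^bsub>G\<^esub> x then f y * g z else 0)"
      using that assms(3) by (intro sum.cong refl if_cong) (auto simp: inv_solve_left)
    then show ?thesis
      using that assms by simp
  qed
  then show ?thesis
    using assms by (simp add: int_group_ring_mult)
qed

lemma semiring_int_group_ring:
  assumes "monoid G" "finite (carrier G)"
  shows "semiring (int_group_ring G)"
proof -
  interpret monoid G by fact
  let ?A = "int_group_ring G"
  note mult = int_group_ring_mult[OF assms(2)]
  \<comment> \<open>Both bracketings are the sum over all triples with product \<open>x\<close>.\<close>
  have assoc: "(f \<otimes>\<^bsub>?A\<^esub> g) \<otimes>\<^bsub>?A\<^esub> h = f \<otimes>\<^bsub>?A\<^esub> (g \<otimes>\<^bsub>?A\<^esub> h)" for f g h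
  proof
    fix x
    let ?C = "carrier G"
    have L: "(\<Sum>y\<in>?C. if y \<otimes>\<^bsub>G\<^esub> c = x then (\<Sum>a\<in>?C. \<Sum>b\<in>?C. if a \<otimes>\<^bsub>G\<^esub> b = y then f a * g b else 0) * h c else 0)
        = (\<Sum>a\<in>?C. \<Sum>b\<in>?C. if a \<otimes>\<^bsub>G\<^esub> b \<otimes>\<^bsub>G\<^esub> c = x then f a * g b * h c else 0)" for c
    proof -
      have "(\<Sum>y\<in>?C. if y \<otimes>\<^bsub>G\<^esub> c = x then (\<Sum>a\<in>?C. \<Sum>b\<in>?C. if a \<otimes>\<^bsub>G\<^esub> b = y then f a * g b else 0) * h c else 0)
          = (\<Sum>y\<in>?C. \<Sum>a\<in>?C. \<Sum>b\<in>?C. if y = a \<otimes>\<^bsub>G\<^esub> b then (if y \<otimes>\<^bsub>G\<^esub> c = x then f a * g b * h c else 0) else 0)"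
        by (intro sum.cong refl) (auto simp: sum_distrib_right intro!: sum.cong sum.neutral)
      also have "\<dots> = (\<Sum>a\<in>?C. \<Sum>b\<in>?C. \<Sum>y\<in>?C. if y = a \<otimes>\<^bsub>G\<^esub> b then (if y \<otimes>\<^bsub>G\<^esub> c = x then f a * g b * h c else 0) else 0)"
        by (rule trans[OF sum.swap], rule sum.cong[OF refl], rule sum.swap)
      finally show ?thesis
        using assms(2) by (simp add: sum.delta cong: sum.cong)
    qed
    have R: "(\<Sum>z\<in>?C. if a \<otimes>\<^bsub>G\<^esub> z = x then f a * (\<Sum>b\<in>?C. \<Sum>c\<in>?C. if b \<otimes>\<^bsub>G\<^esub> c = z then g b * h c else 0) else 0)
        = (\<Sum>b\<in>?C. \<Sum>c\<in>?C. if a \<otimes>\<^bsub>G\<^esub> (b \<otimes>\<^bsub>G\<^esub> c) = x then f a * g b * h c else 0)" for a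
    proof -
      have "(\<Sum>z\<in>?C. if a \<otimes>\<^bsub>G\<^esub> z = x then f a * (\<Sum>b\<in>?C. \<Sum>c\<in>?C. if b \<otimes>\<^bsub>G\<^esub> c = z then g b * h c else 0) else 0)
          = (\<Sum>z\<in>?C. \<Sum>b\<in>?C. \<Sum>c\<in>?C. if z = b \<otimes>\<^bsub>G\<^esub> c then (if a \<otimes>\<^bsub>G\<^esub> z = x then f a * g b * h c else 0) else 0)"
        by (intro sum.cong refl) (auto simp: sum_distrib_left mult.assoc intro!: sum.cong sum.neutral)
      also have "\<dots> = (\<Sum>b\<in>?C. \<Sum>c\<in>?C. \<Sum>z\<in>?C. if z = b \<otimes>\<^bsub>G\<^esub> c then (if a \<otimes>\<^bsub>G\<^esub> z = x then f a * g b * h c else 0) else 0)"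
        by (rule trans[OF sum.swap], rule sum.cong[OF refl], rule sum.swap)
      finally show ?thesis
        using assms(2) by (simp add: sum.delta cong: sum.cong)
    qed
    have "((f \<otimes>\<^bsub>?A\<^esub> g) \<otimes>\<^bsub>?A\<^esub> h) x
        = (\<Sum>c\<in>?C. \<Sum>a\<in>?C. \<Sum>b\<in>?C. if a \<otimes>\<^bsub>G\<^esub> b \<otimes>\<^bsub>G\<^esub> c = x then f a * g b * h c else 0)"
      unfolding mult by (subst sum.swap) (simp add: L)
    also have "\<dots> = (\<Sum>a\<in>?C. \<Sum>b\<in>?C. \<Sum>c\<in>?C. if a \<otimes>\<^bsub>G\<^esub> b \<otimes>\<^bsub>G\<^esub> c = x then f a * g b * h c else 0)"
      by (rule trans[OF sum.swap], rule sum.cong[OF refl], rule sum.swap)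
    also have "\<dots> = (f \<otimes>\<^bsub>?A\<^esub> (g \<otimes>\<^bsub>?A\<^esub> h)) x"
      unfolding mult by (simp add: R m_assoc cong: sum.cong)
    finally show "((f \<otimes>\<^bsub>?A\<^esub> g) \<otimes>\<^bsub>?A\<^esub> h) x = (f \<otimes>\<^bsub>?A\<^esub> (g \<otimes>\<^bsub>?A\<^esub> h)) x" .
  qed
  have supp: "(f \<otimes>\<^bsub>?A\<^esub> g) x = 0" if "x \<notin> carrier G" for f g x
    unfolding mult using that by (intro sum.neutral ballI) auto
  have one_l: "\<one>\<^bsub>?A\<^esub> \<otimes>\<^bsub>?A\<^esub> f = f" and one_r: "f \<otimes>\<^bsub>?A\<^esub> \<one>\<^bsub>?A\<^esub> = f" if "f \<in> carrier ?A" for f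
  proof -
    show "\<one>\<^bsub>?A\<^esub> \<otimes>\<^bsub>?A\<^esub> f = f"
    proof
      fix x
      have "(\<one>\<^bsub>?A\<^esub> \<otimes>\<^bsub>?A\<^esub> f) x
          = (\<Sum>y\<in>carrier G. if y = \<one>\<^bsub>G\<^esub> then (\<Sum>z\<in>carrier G. if z = x then f z else 0) else 0)"
        unfolding mult by (intro sum.cong refl) (auto intro!: sum.cong sum.neutral)
      then show "(\<one>\<^bsub>?A\<^esub> \<otimes>\<^bsub>?A\<^esub> f) x = f x"
        using assms(2) that by simp
    qed
    show "f \<otimes>\<^bsub>?A\<^esub> \<one>\<^bsub>?A\<^esub> = f"
    proof
      fix x
      have "(f \<otimes>\<^bsub>?A\<^esub> \<one>\<^bsub>?A\<^esub>) x
          = (\<Sum>y\<in>carrier G. \<Sum>z\<in>carrier G. if z = \<one>\<^bsub>G\<^esub> then (if y = x then f y else 0) else 0)"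
        unfolding mult by (intro sum.cong refl) auto
      then show "(f \<otimes>\<^bsub>?A\<^esub> \<one>\<^bsub>?A\<^esub>) x = f x"
        using assms(2) that by simp
    qed
  qed
  have distl: "(f \<oplus>\<^bsub>?A\<^esub> g) \<otimes>\<^bsub>?A\<^esub> h = f \<otimes>\<^bsub>?A\<^esub> h \<oplus>\<^bsub>?A\<^esub> g \<otimes>\<^bsub>?A\<^esub> h"
    and distr: "h \<otimes>\<^bsub>?A\<^esub> (f \<oplus>\<^bsub>?A\<^esub> g) = h \<otimes>\<^bsub>?A\<^esub> f \<oplus>\<^bsub>?A\<^esub> h \<otimes>\<^bsub>?A\<^esub> g" for f g h
    by (auto simp: mult fun_eq_iff algebra_simps simp flip: sum.distrib intro!: sum.cong)
  have null: "\<zero>\<^bsub>?A\<^esub> \<otimes>\<^bsub>?A\<^esub> f = \<zero>\<^bsub>?A\<^esub>" "f \<otimes>\<^bsub>?A\<^esub> \<zero>\<^bsub>?A\<^esub> = \<zero>\<^bsub>?A\<^esub>" for f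
    by (auto simp: mult fun_eq_iff intro!: sum.neutral)
  show ?thesis
  proof (rule semiring.intro)
    show "abelian_monoid ?A"
      by (rule abelian_monoidI) (auto simp: fun_eq_iff)
    show "monoid ?A"
      by (rule monoidI) (use assoc one_l one_r supp in auto)
    show "semiring_axioms ?A"
      using distl distr null by unfold_locales blast+
  qed
qed

lemma int_group_ring_add_pow: "[(n::nat)] \<cdot>\<^bsub>int_group_ring G\<^esub> f = (\<lambda>x. int n * f x)"
  by (induction n) (simp_all add: add_pow_def int_group_ring_def fun_eq_iff algebra_simps)

lemma int_group_ring_finsum:
  assumes "finite I" "\<And>i. i \<in> I \<Longrightarrow> v i \<in> carrier (int_group_ring G)"
  shows "(\<Oplus>\<^bsub>int_group_ring G\<^esub>i\<in>I. v i) = (\<lambda>x. \<Sum>i\<in>I. v i x)"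
proof -
  interpret abelian_monoid "int_group_ring G"
    by (rule abelian_monoidI) (auto simp: fun_eq_iff)
  show ?thesis
    using assms by (induction I) (simp_all add: Pi_def)
qed

section \<open>The symmetric group on three letters\<close>

lemma S3_values:
  "S3_s 1 = 2" "S3_s 2 = 1" "S3_s 3 = 3" "S3_t 1 = 1" "S3_t 2 = 3" "S3_t 3 = 2"
  by (simp_all add: Transposition.transpose_def)

text \<open>
  The images of the first two letters already separate the six permutations.
\<close>

lemma S3_distinct:
  "distinct [id, S3_s, S3_t, S3_s \<circ> S3_t, S3_t \<circ> S3_s, S3_w0]"
proof -
  have "distinct (map (\<lambda>p. (p 1, p 2)) [id, S3_s, S3_t, S3_s \<circ> S3_t, S3_t \<circ> S3_s, S3_w0])"
    by (simp add: S3_w0_def S3_values)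
  then show ?thesis
    unfolding distinct_map by blast
qed

text \<open>
  Six distinct elements exhaust a group of order \<open>3!\<close>.
\<close>

lemma carrier_S3: "carrier S3 = {id, S3_s, S3_t, S3_s \<circ> S3_t, S3_t \<circ> S3_s, S3_w0}"
proof -
  let ?L = "[id, S3_s, S3_t, S3_s \<circ> S3_t, S3_t \<circ> S3_s, S3_w0]"
  have *: "S3_s permutes {1..3}" "S3_t permutes {1..3}"
    by (auto intro!: permutes_swap_id)
  have "set ?L = carrier S3"
  proof (rule card_subset_eq)
    show "finite (carrier S3)"
      by (simp add: sym_group_def finite_permutations)
    show "set ?L \<subseteq> carrier S3"
      using * by (auto simp: sym_group_def S3_w0_def intro!: permutes_compose permutes_id)
    show "card (set ?L) = card (carrier S3)"
      using distinct_card[OF S3_distinct] by (simp add: sym_group_card_carrier fact_numeral)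
  qed
  then show ?thesis by simp
qed

lemma S3_cases [consumes 1, case_names id s t st ts w0]:
  assumes "w \<in> carrier S3"
  obtains "w = id" | "w = S3_s" | "w = S3_t" | "w = S3_s \<circ> S3_t" | "w = S3_t \<circ> S3_s" | "w = S3_w0"
  using assms by (auto simp: carrier_S3)

lemma S3_mem [simp]:
  "id \<in> carrier S3" "S3_s \<in> carrier S3" "S3_t \<in> carrier S3" "S3_s \<circ> S3_t \<in> carrier S3"
  "S3_t \<circ> S3_s \<in> carrier S3" "S3_w0 \<in> carrier S3"
  by (simp_all add: carrier_S3)

lemma finite_S3 [simp]: "finite (carrier S3)"
  by (simp add: carrier_S3)

lemma S3_neq:
  "S3_s \<noteq> id" "S3_t \<noteq> id" "S3_s \<circ> S3_t \<noteq> id" "S3_t \<circ> S3_s \<noteq> id" "S3_w0 \<noteq> id"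
  "S3_t \<noteq> S3_s" "S3_s \<circ> S3_t \<noteq> S3_s" "S3_t \<circ> S3_s \<noteq> S3_s" "S3_w0 \<noteq> S3_s"
  "S3_s \<circ> S3_t \<noteq> S3_t" "S3_t \<circ> S3_s \<noteq> S3_t" "S3_w0 \<noteq> S3_t"
  "S3_t \<circ> S3_s \<noteq> S3_s \<circ> S3_t" "S3_w0 \<noteq> S3_s \<circ> S3_t" "S3_w0 \<noteq> S3_t \<circ> S3_s"
  using S3_distinct unfolding distinct.simps list.set insert_iff empty_iff by metis+

lemmas S3_distinct_simps = S3_neq S3_neq[symmetric]

text \<open>
  Oriented as rewrite rules, these bring \<open>s \<circ> x\<close> and \<open>t \<circ> x\<close> into one of the six reduced forms
  for every \<open>x\<close> of the group.
\<close>

lemma S3_relations: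
  fixes p :: "'a \<Rightarrow> nat"
  shows
  "S3_s \<circ> S3_s = id" "S3_t \<circ> S3_t = id" "S3_s \<circ> (S3_s \<circ> p) = p" "S3_t \<circ> (S3_t \<circ> p) = p"
  "S3_s \<circ> (S3_t \<circ> S3_s) = S3_w0" "S3_t \<circ> (S3_s \<circ> S3_t) = S3_w0"
  "S3_s \<circ> S3_w0 = S3_t \<circ> S3_s" "S3_t \<circ> S3_w0 = S3_s \<circ> S3_t"
proof -
  have s: "S3_s \<circ> S3_s = id" and t: "S3_t \<circ> S3_t = id" by (simp_all add: fun_eq_iff)
  have s': "S3_s \<circ> (S3_s \<circ> p) = p" and t': "S3_t \<circ> (S3_t \<circ> p) = p" for p :: "'b \<Rightarrow> nat"
    unfolding comp_assoc[symmetric] s t by simp_all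
  have st: "S3_s \<circ> (S3_t \<circ> S3_s) = S3_w0" by (simp add: S3_w0_def comp_assoc)
  have ts: "S3_t \<circ> (S3_s \<circ> S3_t) = S3_w0"
    by (auto simp: S3_w0_def fun_eq_iff Transposition.transpose_def)
  show "S3_s \<circ> S3_s = id" "S3_t \<circ> S3_t = id" "S3_s \<circ> (S3_s \<circ> p) = p" "S3_t \<circ> (S3_t \<circ> p) = p"
    "S3_s \<circ> (S3_t \<circ> S3_s) = S3_w0" "S3_t \<circ> (S3_s \<circ> S3_t) = S3_w0"
    by (rule s t s' t' st ts)+
  show "S3_s \<circ> S3_w0 = S3_t \<circ> S3_s" by (simp only: st[symmetric] s')
  show "S3_t \<circ> S3_w0 = S3_s \<circ> S3_t" by (simp only: ts[symmetric] t')
qed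

lemma S3_w0_comp: "S3_w0 \<circ> p = S3_s \<circ> (S3_t \<circ> (S3_s \<circ> p))"
  by (simp add: S3_w0_def comp_assoc)

section \<open>The Kazhdan-Lusztig semiring\<close>

abbreviation ZS3 :: "((nat \<Rightarrow> nat) \<Rightarrow> int) ring"
  where "ZS3 \<equiv> int_group_ring S3"

lemma kl_support_simps [simp]:
  "kl_support id = {id}"
  "kl_support S3_s = {id, S3_s}"
  "kl_support S3_t = {id, S3_t}"
  "kl_support (S3_s \<circ> S3_t) = {id, S3_s, S3_t, S3_s \<circ> S3_t}"
  "kl_support (S3_t \<circ> S3_s) = {id, S3_s, S3_t, S3_t \<circ> S3_s}"
  "kl_support S3_w0 = {id, S3_s, S3_t, S3_s \<circ> S3_t, S3_t \<circ> S3_s, S3_w0}"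
  by (simp_all only: kl_support_def S3_distinct_simps if_True if_False refl)

lemma kl_support_subset: "kl_support w \<subseteq> carrier S3"
  unfolding kl_support_def carrier_S3 by auto

lemma kl_basis_carrier: "kl_basis w \<in> carrier ZS3"
  using kl_support_subset by (auto simp: kl_basis_def)

lemma kl_basis_id: "kl_basis id = \<one>\<^bsub>ZS3\<^esub>"
  by (auto simp: kl_basis_def sym_group_one)

lemma sum_S3:
  "(\<Sum>w\<in>carrier S3. g w) = g id + g S3_s + g S3_t + g (S3_s \<circ> S3_t) + g (S3_t \<circ> S3_s) + g S3_w0"
  unfolding carrier_S3 using S3_neq by (simp add: add.assoc)

lemma nat_comb_kl_basis:
  "nat_comb ZS3 c kl_basis = (\<lambda>x. \<Sum>w\<in>carrier S3. int (c w) * kl_basis w x)"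
  unfolding nat_comb_def int_group_ring_add_pow using kl_basis_carrier
  by (subst int_group_ring_finsum) auto

lemma nat_comb_kl_basis_add:
  "nat_comb ZS3 (\<lambda>w. c w + d w) kl_basis = nat_comb ZS3 c kl_basis \<oplus>\<^bsub>ZS3\<^esub> nat_comb ZS3 d kl_basis"
  by (simp add: nat_comb_kl_basis algebra_simps sum.distrib)

lemma nat_comb_kl_basis_single:
  assumes "u \<in> carrier S3"
  shows "nat_comb ZS3 (\<lambda>w. if w = u then 1 else 0) kl_basis = kl_basis u"
  using assms by (auto simp: nat_comb_kl_basis if_distrib if_distribR cong: if_cong)

text \<open>
  The basis is triangular with respect to the Bruhat order: comparing values at \<open>w0\<close>, then at the
  elements of length two, one and zero determines the coefficients one after the other.
\<close>

lemma kl_basis_independent: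
  assumes "nat_comb ZS3 c kl_basis = nat_comb ZS3 d kl_basis" "w \<in> carrier S3"
  shows "c w = d w"
proof -
  have eq: "(\<Sum>w\<in>carrier S3. int (c w) * kl_basis w x) = (\<Sum>w\<in>carrier S3. int (d w) * kl_basis w x)" for x
    using assms(1) unfolding nat_comb_kl_basis by (rule fun_cong)
  show ?thesis
    using assms(2) eq[of id] eq[of S3_s] eq[of S3_t] eq[of "S3_s \<circ> S3_t"] eq[of "S3_t \<circ> S3_s"] eq[of S3_w0]
    unfolding carrier_S3 insert_iff empty_iff
    by (auto simp: sum_S3 kl_basis_def S3_distinct_simps)
qed

lemma inv_S3:
  "inv\<^bsub>S3\<^esub> id = id" "inv\<^bsub>S3\<^esub> S3_s = S3_s" "inv\<^bsub>S3\<^esub> S3_t = S3_t"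
  "inv\<^bsub>S3\<^esub> (S3_s \<circ> S3_t) = S3_t \<circ> S3_s" "inv\<^bsub>S3\<^esub> (S3_t \<circ> S3_s) = S3_s \<circ> S3_t"
  "inv\<^bsub>S3\<^esub> S3_w0 = S3_w0"
proof -
  interpret group S3 by (rule sym_group_is_group)
  have "inv\<^bsub>S3\<^esub> x = y" if "y \<circ> x = id" "x \<in> carrier S3" "y \<in> carrier S3" for x y
    using inv_equality[of y x] that by (simp add: sym_group_mult sym_group_one)
  then show "inv\<^bsub>S3\<^esub> id = id" "inv\<^bsub>S3\<^esub> S3_s = S3_s" "inv\<^bsub>S3\<^esub> S3_t = S3_t"
    "inv\<^bsub>S3\<^esub> (S3_s \<circ> S3_t) = S3_t \<circ> S3_s" "inv\<^bsub>S3\<^esub> (S3_t \<circ> S3_s) = S3_s \<circ> S3_t"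
    "inv\<^bsub>S3\<^esub> S3_w0 = S3_w0"
    by (simp_all add: carrier_S3 comp_assoc S3_relations S3_w0_comp)
qed

lemma ZS3_mult:
  assumes "x \<in> carrier S3"
  shows "(f \<otimes>\<^bsub>ZS3\<^esub> g) x = f id * g x + f S3_s * g (S3_s \<circ> x) + f S3_t * g (S3_t \<circ> x)
    + f (S3_s \<circ> S3_t) * g (S3_t \<circ> (S3_s \<circ> x)) + f (S3_t \<circ> S3_s) * g (S3_s \<circ> (S3_t \<circ> x))
    + f S3_w0 * g (S3_s \<circ> (S3_t \<circ> (S3_s \<circ> x)))"
  using assms by (simp add: int_group_ring_mult_group sym_group_is_group sum_S3 inv_S3
      sym_group_mult comp_assoc S3_w0_comp del: sym_group_inv_equality)

interpretation ZS3: semiring ZS3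
  by (rule semiring_int_group_ring) (simp_all add: group.is_monoid sym_group_is_group)

lemma ZS3_eqI:
  assumes "f \<in> carrier ZS3" "g \<in> carrier ZS3" "f id = g id" "f S3_s = g S3_s" "f S3_t = g S3_t"
    "f (S3_s \<circ> S3_t) = g (S3_s \<circ> S3_t)" "f (S3_t \<circ> S3_s) = g (S3_t \<circ> S3_s)" "f S3_w0 = g S3_w0"
  shows "f = g"
proof
  fix x
  show "f x = g x"
    using assms by (cases "x \<in> carrier S3") (auto elim: S3_cases)
qed

text \<open>
  The products with the generators \<open>s\<close>, \<open>t\<close>, \<open>w0\<close> on the left. The element \<open>w0\<close> is kept as a
  generator, since the relation \<open>sts = w0 + s\<close> cannot be solved for it without subtraction.
\<close>

lemma kl_basis_mult:
  "kl_basis S3_s \<otimes>\<^bsub>ZS3\<^esub> kl_basis S3_s = kl_basis S3_s \<oplus>\<^bsub>ZS3\<^esub> kl_basis S3_s"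
  "kl_basis S3_s \<otimes>\<^bsub>ZS3\<^esub> kl_basis S3_t = kl_basis (S3_s \<circ> S3_t)"
  "kl_basis S3_s \<otimes>\<^bsub>ZS3\<^esub> kl_basis (S3_t \<circ> S3_s) = kl_basis S3_w0 \<oplus>\<^bsub>ZS3\<^esub> kl_basis S3_s"
  "kl_basis S3_s \<otimes>\<^bsub>ZS3\<^esub> kl_basis S3_w0 = kl_basis S3_w0 \<oplus>\<^bsub>ZS3\<^esub> kl_basis S3_w0"
  "kl_basis S3_t \<otimes>\<^bsub>ZS3\<^esub> kl_basis S3_t = kl_basis S3_t \<oplus>\<^bsub>ZS3\<^esub> kl_basis S3_t"
  "kl_basis S3_t \<otimes>\<^bsub>ZS3\<^esub> kl_basis S3_s = kl_basis (S3_t \<circ> S3_s)"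
  "kl_basis S3_t \<otimes>\<^bsub>ZS3\<^esub> kl_basis (S3_s \<circ> S3_t) = kl_basis S3_w0 \<oplus>\<^bsub>ZS3\<^esub> kl_basis S3_t"
  "kl_basis S3_t \<otimes>\<^bsub>ZS3\<^esub> kl_basis S3_w0 = kl_basis S3_w0 \<oplus>\<^bsub>ZS3\<^esub> kl_basis S3_w0"
  "kl_basis S3_w0 \<otimes>\<^bsub>ZS3\<^esub> kl_basis S3_s = kl_basis S3_w0 \<oplus>\<^bsub>ZS3\<^esub> kl_basis S3_w0"
  "kl_basis S3_w0 \<otimes>\<^bsub>ZS3\<^esub> kl_basis S3_t = kl_basis S3_w0 \<oplus>\<^bsub>ZS3\<^esub> kl_basis S3_w0"
  "kl_basis S3_s \<otimes>\<^bsub>ZS3\<^esub> kl_basis (S3_s \<circ> S3_t) = kl_basis (S3_s \<circ> S3_t) \<oplus>\<^bsub>ZS3\<^esub> kl_basis (S3_s \<circ> S3_t)"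
  "kl_basis S3_t \<otimes>\<^bsub>ZS3\<^esub> kl_basis (S3_t \<circ> S3_s) = kl_basis (S3_t \<circ> S3_s) \<oplus>\<^bsub>ZS3\<^esub> kl_basis (S3_t \<circ> S3_s)"
  "kl_basis S3_w0 \<otimes>\<^bsub>ZS3\<^esub> kl_basis (S3_s \<circ> S3_t) =
      kl_basis S3_w0 \<oplus>\<^bsub>ZS3\<^esub> kl_basis S3_w0 \<oplus>\<^bsub>ZS3\<^esub> kl_basis S3_w0 \<oplus>\<^bsub>ZS3\<^esub> kl_basis S3_w0"
  "kl_basis S3_w0 \<otimes>\<^bsub>ZS3\<^esub> kl_basis (S3_t \<circ> S3_s) =
      kl_basis S3_w0 \<oplus>\<^bsub>ZS3\<^esub> kl_basis S3_w0 \<oplus>\<^bsub>ZS3\<^esub> kl_basis S3_w0 \<oplus>\<^bsub>ZS3\<^esub> kl_basis S3_w0"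
  "kl_basis S3_w0 \<otimes>\<^bsub>ZS3\<^esub> kl_basis S3_w0 =
      kl_basis S3_w0 \<oplus>\<^bsub>ZS3\<^esub> kl_basis S3_w0 \<oplus>\<^bsub>ZS3\<^esub> kl_basis S3_w0 \<oplus>\<^bsub>ZS3\<^esub> kl_basis S3_w0 \<oplus>\<^bsub>ZS3\<^esub> kl_basis S3_w0 \<oplus>\<^bsub>ZS3\<^esub> kl_basis S3_w0"
  by (rule ZS3_eqI; (intro ZS3.m_closed ZS3.a_closed kl_basis_carrier
      | simp only: S3_mem[THEN ZS3_mult] kl_basis_def kl_support_simps S3_distinct_simps S3_relations
          comp_id id_comp if_True if_False insert_iff empty_iff refl simp_thms int_group_ring_simps(4)
          mult_1_left mult_zero_left mult_1_right mult_zero_right add_0_left add_0_right))+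

\<comment> \<open>From here on sums in the group ring are handled through the semiring laws, not pointwise.\<close>
declare int_group_ring_simps [simp del]

lemma KL_S3_ops:
  "mult KL_S3 = mult ZS3" "one KL_S3 = kl_basis id" "zero KL_S3 = zero ZS3" "add KL_S3 = add ZS3"
  by (auto simp: KL_S3_def int_group_ring_def kl_basis_def sym_group_one fun_eq_iff)

lemma KL_S3_carrier: "r \<in> carrier KL_S3 \<longleftrightarrow> (\<exists>c. r = nat_comb ZS3 c kl_basis)"
  by (auto simp: KL_S3_def)

lemma KL_S3_carrierI: "nat_comb ZS3 c kl_basis \<in> carrier KL_S3"
  by (auto simp: KL_S3_carrier)

lemma KL_S3_subset: "carrier KL_S3 \<subseteq> carrier ZS3"
  using kl_basis_carrier
  by (auto simp: KL_S3_carrier nat_comb_def intro!: ZS3.finsum_closed ZS3.add.nat_pow_closed)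

lemma KL_S3_zero_closed: "\<zero>\<^bsub>ZS3\<^esub> \<in> carrier KL_S3"
  using KL_S3_carrierI[of "\<lambda>_. 0"] by (simp add: nat_comb_kl_basis int_group_ring_simps)

lemma KL_S3_basis_closed: "w \<in> carrier S3 \<Longrightarrow> kl_basis w \<in> carrier KL_S3"
  using KL_S3_carrierI nat_comb_kl_basis_single by metis

lemma KL_S3_add_closed:
  "a \<in> carrier KL_S3 \<Longrightarrow> b \<in> carrier KL_S3 \<Longrightarrow> a \<oplus>\<^bsub>ZS3\<^esub> b \<in> carrier KL_S3"
  unfolding KL_S3_carrier by (auto simp only: nat_comb_kl_basis_add[symmetric])

text \<open>
  The semiring is additively generated by the basis, so additive properties of its elements only have
  to be checked on six elements.
\<close>

lemma KL_S3_additive_induct [consumes 1, case_names zero basis add]: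
  assumes r: "r \<in> carrier KL_S3"
    and zero: "P \<zero>\<^bsub>KL_S3\<^esub>"
    and basis: "\<And>w. w \<in> carrier S3 \<Longrightarrow> P (kl_basis w)"
    and add: "\<And>a b. \<lbrakk>a \<in> carrier KL_S3; b \<in> carrier KL_S3; P a; P b\<rbrakk> \<Longrightarrow> P (a \<oplus>\<^bsub>KL_S3\<^esub> b)"
  shows "P r"
proof -
  obtain c :: "(nat \<Rightarrow> nat) \<Rightarrow> nat" where c: "r = (\<Oplus>\<^bsub>ZS3\<^esub>w\<in>carrier S3. [c w] \<cdot>\<^bsub>ZS3\<^esub> kl_basis w)"
    using r unfolding KL_S3_carrier nat_comb_def by blast
  define Q where "Q a \<longleftrightarrow> a \<in> carrier KL_S3 \<and> P a" for a
  have Q0: "Q \<zero>\<^bsub>ZS3\<^esub>"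
    using zero KL_S3_zero_closed by (simp add: Q_def KL_S3_ops)
  have Qadd: "Q (a \<oplus>\<^bsub>ZS3\<^esub> b)" if "Q a" "Q b" for a b
    using add[of a b] KL_S3_add_closed[of a b] that by (simp add: Q_def KL_S3_ops)
  have Qpow: "Q ([n] \<cdot>\<^bsub>ZS3\<^esub> kl_basis w)" if "w \<in> carrier S3" for n :: nat and w
  proof (induction n)
    case 0
    show ?case using Q0 by (simp add: add_pow_def)
  next
    case (Suc n)
    have "Q ([n] \<cdot>\<^bsub>ZS3\<^esub> kl_basis w \<oplus>\<^bsub>ZS3\<^esub> kl_basis w)"
      using Suc that by (intro Qadd) (simp_all add: Q_def basis KL_S3_basis_closed)
    then show ?case by (simp add: add_pow_def)
  qed
  have "Q (\<Oplus>\<^bsub>ZS3\<^esub>w\<in>F. [c w] \<cdot>\<^bsub>ZS3\<^esub> kl_basis w)" if "finite F" "F \<subseteq> carrier S3" for F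
    using that
  proof (induction F)
    case empty
    show ?case using Q0 by simp
  next
    case (insert u F)
    have "(\<Oplus>\<^bsub>ZS3\<^esub>w\<in>insert u F. [c w] \<cdot>\<^bsub>ZS3\<^esub> kl_basis w)
        = [c u] \<cdot>\<^bsub>ZS3\<^esub> kl_basis u \<oplus>\<^bsub>ZS3\<^esub> (\<Oplus>\<^bsub>ZS3\<^esub>w\<in>F. [c w] \<cdot>\<^bsub>ZS3\<^esub> kl_basis w)"
      using insert.hyps kl_basis_carrier by (intro ZS3.finsum_insert) auto
    then show ?case
      using insert Qpow Qadd by auto
  qed
  from this[OF finite_S3 subset_refl] show ?thesis
    by (simp add: c Q_def)
qed

text \<open>
  The products with \<open>s\<close>, \<open>t\<close>, \<open>w0\<close> are known; a basis element of length two is a product of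
  two generators, so multiplying by it amounts to multiplying twice.
\<close>

lemma kl_basis_mult_closed:
  assumes "u \<in> carrier S3" "w \<in> carrier S3"
  shows "kl_basis u \<otimes>\<^bsub>ZS3\<^esub> kl_basis w \<in> carrier KL_S3"
proof -
  note closed = KL_S3_add_closed KL_S3_basis_closed
  have gen: "kl_basis u \<otimes>\<^bsub>ZS3\<^esub> q \<in> carrier KL_S3"
    if "q \<in> carrier KL_S3" "u = S3_s \<or> u = S3_t \<or> u = S3_w0" for u q
    using that(1)
  proof (induction q rule: KL_S3_additive_induct)
    case zero
    show ?case
      using kl_basis_carrier by (simp add: KL_S3_ops KL_S3_zero_closed)
  next
    case (basis w)
    then show ?case using that(2)
      by (cases rule: S3_cases)
        (elim disjE; simp add: kl_basis_mult closed kl_basis_id kl_basis_carrier)+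
  next
    case (add a b)
    then show ?case
      using KL_S3_subset kl_basis_carrier
      by (auto simp: KL_S3_ops ZS3.r_distr subset_iff intro: KL_S3_add_closed)
  qed
  note w = KL_S3_basis_closed[OF assms(2)]
  have "kl_basis S3_s \<otimes>\<^bsub>ZS3\<^esub> (kl_basis S3_t \<otimes>\<^bsub>ZS3\<^esub> kl_basis w) \<in> carrier KL_S3"
    "kl_basis S3_t \<otimes>\<^bsub>ZS3\<^esub> (kl_basis S3_s \<otimes>\<^bsub>ZS3\<^esub> kl_basis w) \<in> carrier KL_S3"
    using w by (auto intro!: gen)
  then have "kl_basis (S3_s \<circ> S3_t) \<otimes>\<^bsub>ZS3\<^esub> kl_basis w \<in> carrier KL_S3"
    "kl_basis (S3_t \<circ> S3_s) \<otimes>\<^bsub>ZS3\<^esub> kl_basis w \<in> carrier KL_S3"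
    using kl_basis_carrier by (simp_all add: kl_basis_mult flip: ZS3.m_assoc)
  with assms(1) w gen show ?thesis
    by (cases rule: S3_cases) (simp_all add: kl_basis_id kl_basis_carrier)
qed

lemma KL_S3_mult_closed:
  assumes "a \<in> carrier KL_S3" "b \<in> carrier KL_S3"
  shows "a \<otimes>\<^bsub>ZS3\<^esub> b \<in> carrier KL_S3"
proof -
  have *: "kl_basis u \<otimes>\<^bsub>ZS3\<^esub> b \<in> carrier KL_S3" if u: "u \<in> carrier S3" for u
    using assms(2)
  proof (induction b rule: KL_S3_additive_induct)
    case zero
    show ?case using kl_basis_carrier by (simp add: KL_S3_ops KL_S3_zero_closed)
  next
    case (basis w)
    then show ?case by (intro kl_basis_mult_closed u)
  next
    case (add a b)
    then show ?case
      using KL_S3_subset kl_basis_carrier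
      by (auto simp: KL_S3_ops ZS3.r_distr subset_iff intro: KL_S3_add_closed)
  qed
  have b: "b \<in> carrier ZS3" using assms(2) KL_S3_subset by auto
  show ?thesis using assms(1)
  proof (induction a rule: KL_S3_additive_induct)
    case zero
    show ?case using b by (simp add: KL_S3_ops KL_S3_zero_closed)
  next
    case (basis w)
    then show ?case by (rule *)
  next
    case (add a a')
    then show ?case
      using KL_S3_subset b
      by (auto simp: KL_S3_ops ZS3.l_distr subset_iff intro: KL_S3_add_closed)
  qed
qed

interpretation KL: semiring KL_S3
proof (rule semiring.intro)
  note in_ZS3 = subsetD[OF KL_S3_subset]
  show "abelian_monoid KL_S3"
    by (rule abelian_monoidI)
      (auto simp: KL_S3_ops KL_S3_add_closed KL_S3_zero_closed in_ZS3 intro: ZS3.a_assoc ZS3.a_comm)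
  show "monoid KL_S3"
    by (rule monoidI)
      (auto simp: KL_S3_ops KL_S3_mult_closed KL_S3_basis_closed[of id, unfolded kl_basis_id]
        in_ZS3 kl_basis_id ZS3.m_assoc)
  show "semiring_axioms KL_S3"
    by unfold_locales (auto simp: KL_S3_ops in_ZS3 ZS3.l_distr ZS3.r_distr)
qed

lemmas KL_S3_basis_mult = kl_basis_mult[folded KL_S3_ops]

text \<open>
  The reduction to three generators that is used for the associativity of actions, for congruences and
  for isomorphisms.
\<close>

lemma KL_S3_induct [consumes 1, case_names zero one s t w0 add mult]:
  assumes r: "r \<in> carrier KL_S3"
    and zero: "P \<zero>\<^bsub>KL_S3\<^esub>" and one: "P \<one>\<^bsub>KL_S3\<^esub>"
    and s: "P (kl_basis S3_s)" and t: "P (kl_basis S3_t)" and w0: "P (kl_basis S3_w0)"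
    and add: "\<And>a b. \<lbrakk>a \<in> carrier KL_S3; b \<in> carrier KL_S3; P a; P b\<rbrakk> \<Longrightarrow> P (a \<oplus>\<^bsub>KL_S3\<^esub> b)"
    and mult: "\<And>a b. \<lbrakk>a \<in> carrier KL_S3; b \<in> carrier KL_S3; P a; P b\<rbrakk> \<Longrightarrow> P (a \<otimes>\<^bsub>KL_S3\<^esub> b)"
  shows "P r"
  using r
proof (induction r rule: KL_S3_additive_induct)
  case (basis w)
  have "P (kl_basis S3_s \<otimes>\<^bsub>KL_S3\<^esub> kl_basis S3_t)" "P (kl_basis S3_t \<otimes>\<^bsub>KL_S3\<^esub> kl_basis S3_s)"
    using s t by (simp_all add: mult KL_S3_basis_closed)
  then have "P (kl_basis (S3_s \<circ> S3_t))" "P (kl_basis (S3_t \<circ> S3_s))"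
    by (simp_all only: KL_S3_basis_mult)
  with basis one s t w0 show ?case
    by (cases rule: S3_cases) (simp_all add: KL_S3_ops)
qed (fact zero, fact add)

lemma kl_coeff_nat_comb:
  assumes "w \<in> carrier S3"
  shows "kl_coeff (nat_comb ZS3 c kl_basis) w = c w"
proof -
  have "nat_comb ZS3 c kl_basis = nat_comb ZS3 (kl_coeff (nat_comb ZS3 c kl_basis)) kl_basis"
    unfolding kl_coeff_def by (rule someI[of _ c]) (rule refl)
  from kl_basis_independent[OF this assms] show ?thesis by simp
qed

lemma nat_comb_kl_coeff:
  assumes "r \<in> carrier KL_S3"
  shows "nat_comb ZS3 (kl_coeff r) kl_basis = r"
  using someI_ex[OF assms[unfolded KL_S3_carrier]] unfolding kl_coeff_def by (rule sym)

lemma kl_coeff_zero: "w \<in> carrier S3 \<Longrightarrow> kl_coeff \<zero>\<^bsub>KL_S3\<^esub> w = 0"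
  using kl_coeff_nat_comb[of w "\<lambda>_. 0"] by (simp add: nat_comb_kl_basis int_group_ring_simps KL_S3_ops)

lemma kl_coeff_basis:
  assumes "u \<in> carrier S3" "w \<in> carrier S3"
  shows "kl_coeff (kl_basis u) w = (if w = u then 1 else 0)"
  using kl_coeff_nat_comb[OF assms(2), of "\<lambda>w. if w = u then 1 else 0"]
  unfolding nat_comb_kl_basis_single[OF assms(1)] .

text \<open>
  By linear independence the chosen coefficients are additive, although they come from a choice that
  is arbitrary outside the group.
\<close>

lemma kl_coeff_add:
  assumes "a \<in> carrier KL_S3" "b \<in> carrier KL_S3" "w \<in> carrier S3"
  shows "kl_coeff (a \<oplus>\<^bsub>KL_S3\<^esub> b) w = kl_coeff a w + kl_coeff b w"
  using kl_coeff_nat_comb[OF assms(3), of "\<lambda>w. kl_coeff a w + kl_coeff b w"] assms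
  by (simp add: nat_comb_kl_basis_add nat_comb_kl_coeff KL_S3_ops)

section \<open>Natural linear combinations in a commutative monoid\<close>

context abelian_monoid
begin

lemma nat_comb_closed:
  "v \<in> carrier S3 \<rightarrow> carrier G \<Longrightarrow> nat_comb G c v \<in> carrier G"
  by (auto simp: nat_comb_def intro!: finsum_closed add.nat_pow_closed)

lemma nat_comb_cong:
  assumes "\<And>w. w \<in> carrier S3 \<Longrightarrow> c w = d w" "\<And>w. w \<in> carrier S3 \<Longrightarrow> u w = v w"
    and "v \<in> carrier S3 \<rightarrow> carrier G"
  shows "nat_comb G c u = nat_comb G d v"
  unfolding nat_comb_def using assms by (intro finsum_cong') (auto simp: Pi_iff)

lemma nat_comb_add_coeff:
  assumes "v \<in> carrier S3 \<rightarrow> carrier G"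
  shows "nat_comb G (\<lambda>w. c w + d w) v = nat_comb G c v \<oplus> nat_comb G d v"
proof -
  have "nat_comb G (\<lambda>w. c w + d w) v = (\<Oplus>w\<in>carrier S3. [c w] \<cdot> v w \<oplus> [d w] \<cdot> v w)"
    unfolding nat_comb_def using assms by (intro finsum_cong') (auto simp: Pi_iff add.nat_pow_mult)
  also have "\<dots> = nat_comb G c v \<oplus> nat_comb G d v"
    unfolding nat_comb_def using assms by (intro finsum_addf) (auto simp: Pi_iff)
  finally show ?thesis .
qed

lemma nat_comb_add_vec:
  assumes "u \<in> carrier S3 \<rightarrow> carrier G" "v \<in> carrier S3 \<rightarrow> carrier G"
  shows "nat_comb G c (\<lambda>w. u w \<oplus> v w) = nat_comb G c u \<oplus> nat_comb G c v"
proof -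
  have "nat_comb G c (\<lambda>w. u w \<oplus> v w) = (\<Oplus>w\<in>carrier S3. [c w] \<cdot> u w \<oplus> [c w] \<cdot> v w)"
    unfolding nat_comb_def using assms by (intro finsum_cong') (auto simp: Pi_iff add.nat_pow_distrib)
  also have "\<dots> = nat_comb G c u \<oplus> nat_comb G c v"
    unfolding nat_comb_def using assms by (intro finsum_addf) (auto simp: Pi_iff)
  finally show ?thesis .
qed

lemma nat_comb_zero_coeff: "nat_comb G (\<lambda>w. 0) v = \<zero>"
  by (simp add: nat_comb_def)

lemma nat_comb_zero_vec: "nat_comb G c (\<lambda>w. \<zero>) = \<zero>"
  by (simp add: nat_comb_def)

lemma nat_comb_single:
  assumes "u \<in> carrier S3" "v \<in> carrier S3 \<rightarrow> carrier G"
  shows "nat_comb G (\<lambda>w. if w = u then 1 else 0) v = v u"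
proof -
  have "nat_comb G (\<lambda>w. if w = u then 1 else 0) v = (\<Oplus>w\<in>carrier S3. if w = u then v w else \<zero>)"
    unfolding nat_comb_def using assms
    by (intro finsum_cong') (auto simp: Pi_iff One_nat_def)
  also have "\<dots> = v u"
    using assms by (intro add.finprod_singleton_swap) auto
  finally show ?thesis .
qed

end

section \<open>Constructing semimodules\<close>

lemma kl_semimodule_simps [simp]:
  "carrier (kl_semimodule A act) = carrier A" "zero (kl_semimodule A act) = zero A"
  "add (kl_semimodule A act) = add A"
  "r \<odot>\<^bsub>kl_semimodule A act\<^esub> x = nat_comb A (kl_coeff r) (\<lambda>w. act w x)"
  by (simp_all add: kl_semimodule_def)

lemma kl_semimodule_basis:
  assumes "abelian_monoid A" "w \<in> carrier S3" "\<And>u. u \<in> carrier S3 \<Longrightarrow> act u x \<in> carrier A"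
  shows "kl_basis w \<odot>\<^bsub>kl_semimodule A act\<^esub> x = act w x"
proof -
  interpret abelian_monoid A by fact
  have "nat_comb A (kl_coeff (kl_basis w)) (\<lambda>w. act w x)
      = nat_comb A (\<lambda>u. if u = w then 1 else 0) (\<lambda>w. act w x)"
    using assms by (intro nat_comb_cong) (auto simp: kl_coeff_basis)
  also have "\<dots> = act w x"
    using assms by (intro nat_comb_single) auto
  finally show ?thesis by simp
qed

text \<open>
  A presentation of the idempotent semimodules: over an idempotent monoid all multiplicities in the
  multiplication table collapse, and the remaining relations between the operators suffice. To verify
  associativity, first take a generator on the left and, by additivity, a basis element on the right;
  this is one line of the table. The elements that act associatively on the left thus include the
  generators; they are closed under sums and products, so they are the whole semiring.
\<close>

lemma semimodule_kl_semimodule: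
  fixes A :: "'b ring" (structure)
  assumes A: "abelian_monoid A"
    and idem: "\<And>x. x \<in> carrier A \<Longrightarrow> x \<oplus> x = x"
    and closed: "\<And>w x. \<lbrakk>w \<in> carrier S3; x \<in> carrier A\<rbrakk> \<Longrightarrow> act w x \<in> carrier A"
    and act_add: "\<And>w x y. \<lbrakk>w \<in> carrier S3; x \<in> carrier A; y \<in> carrier A\<rbrakk> \<Longrightarrow>
      act w (x \<oplus> y) = act w x \<oplus> act w y"
    and act_zero: "\<And>w. w \<in> carrier S3 \<Longrightarrow> act w \<zero> = \<zero>"
    and act_id: "\<And>x. x \<in> carrier A \<Longrightarrow> act id x = x"
    and st: "\<And>x. x \<in> carrier A \<Longrightarrow> act S3_s (act S3_t x) = act (S3_s \<circ> S3_t) x"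
    and ts: "\<And>x. x \<in> carrier A \<Longrightarrow> act S3_t (act S3_s x) = act (S3_t \<circ> S3_s) x"
    and ss: "\<And>x. x \<in> carrier A \<Longrightarrow> act S3_s (act S3_s x) = act S3_s x"
    and tt: "\<And>x. x \<in> carrier A \<Longrightarrow> act S3_t (act S3_t x) = act S3_t x"
    and sts: "\<And>x. x \<in> carrier A \<Longrightarrow> act S3_s (act (S3_t \<circ> S3_s) x) = act S3_w0 x \<oplus> act S3_s x"
    and tst: "\<And>x. x \<in> carrier A \<Longrightarrow> act S3_t (act (S3_s \<circ> S3_t) x) = act S3_w0 x \<oplus> act S3_t x"
    and sw: "\<And>x. x \<in> carrier A \<Longrightarrow> act S3_s (act S3_w0 x) = act S3_w0 x"
    and tw: "\<And>x. x \<in> carrier A \<Longrightarrow> act S3_t (act S3_w0 x) = act S3_w0 x"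
    and ws: "\<And>x. x \<in> carrier A \<Longrightarrow> act S3_w0 (act S3_s x) = act S3_w0 x"
    and wt: "\<And>x. x \<in> carrier A \<Longrightarrow> act S3_w0 (act S3_t x) = act S3_w0 x"
    and ww: "\<And>x. x \<in> carrier A \<Longrightarrow> act S3_w0 (act S3_w0 x) = act S3_w0 x"
  shows "semimodule KL_S3 (kl_semimodule A act)"
proof -
  interpret abelian_monoid A by (rule A)
  let ?N = "kl_semimodule A act"
  have vec: "(\<lambda>w. act w x) \<in> carrier S3 \<rightarrow> carrier A" if "x \<in> carrier A" for x
    using closed that by auto
  have basis_act: "kl_basis w \<odot>\<^bsub>?N\<^esub> x = act w x" if "w \<in> carrier S3" "x \<in> carrier A" for w x
    using that closed by (intro kl_semimodule_basis A)
  have one_act: "\<one>\<^bsub>KL_S3\<^esub> \<odot>\<^bsub>?N\<^esub> x = x" if "x \<in> carrier A" for x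
    using basis_act[of id x] that act_id by (simp add: KL_S3_ops(2) del: kl_semimodule_simps(4))
  have smult_closed: "r \<odot>\<^bsub>?N\<^esub> x \<in> carrier A" if "x \<in> carrier A" for r x
    using vec[OF that] by (simp add: nat_comb_closed)
  have zero_l: "\<zero>\<^bsub>KL_S3\<^esub> \<odot>\<^bsub>?N\<^esub> x = \<zero>" if "x \<in> carrier A" for x
  proof -
    have "nat_comb A (kl_coeff \<zero>\<^bsub>KL_S3\<^esub>) (\<lambda>w. act w x) = nat_comb A (\<lambda>w. 0) (\<lambda>w. act w x)"
      using vec[OF that] by (intro nat_comb_cong) (auto simp: kl_coeff_zero)
    then show ?thesis by (simp add: nat_comb_zero_coeff)
  qed
  have zero_r: "r \<odot>\<^bsub>?N\<^esub> \<zero> = \<zero>" for r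
  proof -
    have "nat_comb A (kl_coeff r) (\<lambda>w. act w \<zero>) = nat_comb A (kl_coeff r) (\<lambda>w. \<zero>)"
      by (intro nat_comb_cong) (auto simp: act_zero)
    then show ?thesis by (simp add: nat_comb_zero_vec)
  qed
  have distr_l: "(a \<oplus>\<^bsub>KL_S3\<^esub> b) \<odot>\<^bsub>?N\<^esub> x = a \<odot>\<^bsub>?N\<^esub> x \<oplus> b \<odot>\<^bsub>?N\<^esub> x"
    if "a \<in> carrier KL_S3" "b \<in> carrier KL_S3" "x \<in> carrier A" for a b x
  proof -
    have "nat_comb A (kl_coeff (a \<oplus>\<^bsub>KL_S3\<^esub> b)) (\<lambda>w. act w x)
        = nat_comb A (\<lambda>w. kl_coeff a w + kl_coeff b w) (\<lambda>w. act w x)"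
      using vec[OF that(3)] that by (intro nat_comb_cong) (auto simp: kl_coeff_add)
    then show ?thesis using vec[OF that(3)] by (simp add: nat_comb_add_coeff)
  qed
  have distr_r: "r \<odot>\<^bsub>?N\<^esub> (x \<oplus> y) = r \<odot>\<^bsub>?N\<^esub> x \<oplus> r \<odot>\<^bsub>?N\<^esub> y"
    if "x \<in> carrier A" "y \<in> carrier A" for r x y
  proof -
    have "nat_comb A (kl_coeff r) (\<lambda>w. act w (x \<oplus> y))
        = nat_comb A (kl_coeff r) (\<lambda>w. act w x \<oplus> act w y)"
      using that closed by (intro nat_comb_cong) (auto simp: act_add)
    then show ?thesis using vec that by (simp add: nat_comb_add_vec)
  qed
  \<comment> \<open>associativity with a generator on the left, by additivity in the right factor\<close>
  have gen: "(kl_basis u \<otimes>\<^bsub>KL_S3\<^esub> q) \<odot>\<^bsub>?N\<^esub> x = kl_basis u \<odot>\<^bsub>?N\<^esub> (q \<odot>\<^bsub>?N\<^esub> x)"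
    if "q \<in> carrier KL_S3" "x \<in> carrier A" "u = S3_s \<or> u = S3_t \<or> u = S3_w0" for u q x
    using that(1)
  proof (induction q rule: KL_S3_additive_induct)
    case zero
    show ?case
      using that(2,3) by (auto simp: KL_S3_basis_closed zero_l zero_r simp del: kl_semimodule_simps(4))
  next
    case (basis w)
    have one: "kl_basis id = \<one>\<^bsub>KL_S3\<^esub>" by (simp add: KL_S3_ops)
    note rels = st ts ss tt sts tst sw tw ws wt ww act_id
    have w0st: "act S3_w0 (act (S3_s \<circ> S3_t) x) = act S3_w0 x"
      "act S3_w0 (act (S3_t \<circ> S3_s) x) = act S3_w0 x"
      "act S3_s (act (S3_s \<circ> S3_t) x) = act (S3_s \<circ> S3_t) x"
      "act S3_t (act (S3_t \<circ> S3_s) x) = act (S3_t \<circ> S3_s) x"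
      using that(2) by (simp_all add: closed rels flip: st ts)
    show ?case using basis that(2,3)
      by (cases rule: S3_cases)
        (elim disjE; simp add: KL_S3_basis_mult basis_act closed rels w0st distr_l idem
          KL_S3_basis_closed one one_act
          del: kl_semimodule_simps(4))+
  next
    case (add a b)
    have "u \<in> carrier S3" using that(3) by auto
    with add show ?case
      using that(2)
      by (simp add: KL.r_distr KL_S3_basis_closed KL.m_closed distr_l distr_r smult_closed
          del: kl_semimodule_simps(4))
  qed
  have assoc: "(r \<otimes>\<^bsub>KL_S3\<^esub> q) \<odot>\<^bsub>?N\<^esub> x = r \<odot>\<^bsub>?N\<^esub> (q \<odot>\<^bsub>?N\<^esub> x)"
    if "r \<in> carrier KL_S3" "q \<in> carrier KL_S3" "x \<in> carrier A" for r q x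
    using that
  proof (induction r arbitrary: q x rule: KL_S3_induct)
  qed (simp_all add: gen one_act zero_l smult_closed KL.m_assoc KL.l_distr distr_l KL.m_closed
      del: kl_semimodule_simps(4))
  show ?thesis
  proof (rule semimodule.intro)
    show "semiring KL_S3" by unfold_locales
    show "abelian_monoid ?N"
      by (rule abelian_monoidI) (auto intro: a_assoc a_comm)
    show "semimodule_axioms KL_S3 ?N"
      by unfold_locales (simp_all add: smult_closed one_act zero_l zero_r distr_l distr_r assoc
          del: kl_semimodule_simps(4))
  qed
qed

lemma subsemimodule:
  fixes M (structure)
  assumes "semimodule R M" "H \<subseteq> carrier M" "\<zero> \<in> H"
    and "\<And>x y. \<lbrakk>x \<in> H; y \<in> H\<rbrakk> \<Longrightarrow> x \<oplus> y \<in> H"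
    and "\<And>r x. \<lbrakk>r \<in> carrier R; x \<in> H\<rbrakk> \<Longrightarrow> r \<odot> x \<in> H"
  shows "semimodule R (M\<lparr>carrier := H\<rparr>)"
proof -
  interpret semimodule R M by fact
  note in_M = subsetD[OF assms(2)]
  show ?thesis
  proof (rule semimodule.intro)
    show "semiring R" by unfold_locales
    show "abelian_monoid (M\<lparr>carrier := H\<rparr>)"
      by (rule abelian_monoidI) (auto simp: assms in_M intro: M.a_assoc M.a_comm)
    show "semimodule_axioms R (M\<lparr>carrier := H\<rparr>)"
      by unfold_locales
        (simp_all add: assms in_M smult_r_distr smult_r_null smult_l_distr smult_assoc smult_l_null smult_one)
  qed
qed

lemma idempotent_not_abelian_group:
  fixes M (structure)
  assumes "x \<in> carrier M" "x \<oplus> x = x" "x \<noteq> \<zero>"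
  shows "\<not> abelian_group M"
proof
  assume "abelian_group M"
  then interpret abelian_group M .
  show False
    using add.l_cancel_one[of x x] assms by simp
qed

text \<open>
  Once \<open>0\<close> is identified with an absorbing element \<open>z\<close>, adding any \<open>x\<close> identifies \<open>x\<close> with
  \<open>z\<close>. Moreover \<open>z\<close> is a nonzero additive idempotent, which cannot exist in a group.
\<close>

lemma elementary_proper_if_absorbing:
  fixes M (structure)
  assumes M: "semimodule R M" and z: "z \<in> carrier M" "z \<noteq> \<zero>" "\<And>x. x \<in> carrier M \<Longrightarrow> z \<oplus> x = z"
    and collapse: "\<And>\<rho> x y. \<lbrakk>semimodule_congruence R M \<rho>; (x, y) \<in> \<rho>; x \<in> carrier M; y \<in> carrier M; x \<noteq> y\<rbrakk>
      \<Longrightarrow> (\<zero>, z) \<in> \<rho>"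
  shows "elementary_semimodule R M \<and> proper_semimodule R M"
proof
  interpret semimodule R M by fact
  have "\<rho> = Id_on (carrier M) \<or> \<rho> = carrier M \<times> carrier M" if \<rho>: "semimodule_congruence R M \<rho>" for \<rho>
  proof -
    have eq: "equiv (carrier M) \<rho>"
      using \<rho> by (simp add: semimodule_congruence_def)
    then have sub: "\<rho> \<subseteq> carrier M \<times> carrier M" and refl: "Id_on (carrier M) \<subseteq> \<rho>"
      by (auto simp: equiv_def refl_on_def)
    show ?thesis
    proof (cases "\<rho> \<subseteq> Id_on (carrier M)")
      case True
      then show ?thesis using refl by blast
    next
      case False
      then obtain x y where "(x, y) \<in> \<rho>" "x \<noteq> y" "x \<in> carrier M" "y \<in> carrier M"
        using sub by auto
      then have 0: "(\<zero>, z) \<in> \<rho>" using collapse \<rho> by blast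
      have z_class: "(x, z) \<in> \<rho>" if "x \<in> carrier M" for x
      proof -
        have "(\<zero> \<oplus> x, z \<oplus> x) \<in> \<rho>"
          using \<rho> 0 that by (auto simp: semimodule_congruence_def)
        then show ?thesis using that z by simp
      qed
      then have "carrier M \<times> carrier M \<subseteq> \<rho>"
        using eq unfolding equiv_def sym_def trans_def by blast
      then show ?thesis using sub by blast
    qed
  qed
  then show "elementary_semimodule R M"
    using M z by (auto simp: elementary_semimodule_def)
  show "proper_semimodule R M"
    using M z idempotent_not_abelian_group[of z M] by (auto simp: proper_semimodule_def)
qed

section \<open>The six semimodules\<close>

lemma abelian_monoid_B: "abelian_monoid B_monoid"
  by (rule abelian_monoidI) (auto simp: B_monoid_def)

lemma abelian_monoid_BB: "abelian_monoid BB_monoid"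
  by (rule abelian_monoidI) (auto simp: BB_monoid_def)

lemma elementary_proper_B:
  assumes "semimodule KL_S3 (kl_semimodule B_monoid act)"
  shows "elementary_semimodule KL_S3 (kl_semimodule B_monoid act)
    \<and> proper_semimodule KL_S3 (kl_semimodule B_monoid act)"
proof (rule elementary_proper_if_absorbing[OF assms])
  fix \<rho> and x y :: bool
  assume "semimodule_congruence KL_S3 (kl_semimodule B_monoid act) \<rho>" "(x, y) \<in> \<rho>" "x \<noteq> y"
  then have "sym \<rho>" "(x, y) \<in> \<rho>" "x \<noteq> y"
    by (auto simp: semimodule_congruence_def equiv_def)
  then show "(\<zero>\<^bsub>kl_semimodule B_monoid act\<^esub>, True) \<in> \<rho>"
    by (cases x) (auto simp: B_monoid_def dest: symD)
qed (simp_all add: B_monoid_def)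

lemma semimodule_M1: "semimodule KL_S3 M1"
  unfolding M1_def by (rule semimodule_kl_semimodule[OF abelian_monoid_B]) (auto simp: B_monoid_def)

lemma semimodule_M2: "semimodule KL_S3 M2"
  unfolding M2_def by (rule semimodule_kl_semimodule[OF abelian_monoid_B])
    (auto simp: B_monoid_def S3_distinct_simps)

lemma semimodule_M3: "semimodule KL_S3 M3"
  unfolding M3_def by (rule semimodule_kl_semimodule[OF abelian_monoid_B])
    (auto simp: B_monoid_def S3_distinct_simps)

lemma M7_act_simps [simp]:
  "M7_act id p = p" "M7_act S3_s p = (fst p, fst p)" "M7_act S3_t p = (snd p, snd p)"
  "M7_act (S3_s \<circ> S3_t) p = (snd p, snd p)" "M7_act (S3_t \<circ> S3_s) p = (fst p, fst p)"
  "M7_act S3_w0 p = (False, False)"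
  by (simp_all add: M7_act_def case_prod_unfold S3_distinct_simps)

lemma semimodule_M7: "semimodule KL_S3 M7"
  unfolding M7_def
proof (rule semimodule_kl_semimodule[OF abelian_monoid_BB])
  fix w and x y :: "bool \<times> bool"
  assume "w \<in> carrier S3"
  then show "M7_act w (x \<oplus>\<^bsub>BB_monoid\<^esub> y) = M7_act w x \<oplus>\<^bsub>BB_monoid\<^esub> M7_act w y"
    and "M7_act w \<zero>\<^bsub>BB_monoid\<^esub> = \<zero>\<^bsub>BB_monoid\<^esub>"
    by (cases rule: S3_cases; simp add: BB_monoid_def case_prod_unfold)+
qed (auto simp: BB_monoid_def)

lemma M1_basis: "w \<in> carrier S3 \<Longrightarrow> kl_basis w \<odot>\<^bsub>M1\<^esub> x = x"
  unfolding M1_def by (subst kl_semimodule_basis[OF abelian_monoid_B]) (auto simp: B_monoid_def)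

lemma M2_basis: "w \<in> carrier S3 \<Longrightarrow> kl_basis w \<odot>\<^bsub>M2\<^esub> x = (w = id \<and> x)"
  unfolding M2_def by (subst kl_semimodule_basis[OF abelian_monoid_B]) (auto simp: B_monoid_def)

lemma M3_basis: "w \<in> carrier S3 \<Longrightarrow> kl_basis w \<odot>\<^bsub>M3\<^esub> x = (w \<noteq> S3_w0 \<and> x)"
  unfolding M3_def by (subst kl_semimodule_basis[OF abelian_monoid_B]) (auto simp: B_monoid_def)

lemma M7_basis: "w \<in> carrier S3 \<Longrightarrow> kl_basis w \<odot>\<^bsub>M7\<^esub> x = M7_act w x"
  unfolding M7_def by (subst kl_semimodule_basis[OF abelian_monoid_BB]) (auto simp: BB_monoid_def)

lemma M7_simps [simp]:
  "carrier M7 = UNIV" "\<zero>\<^bsub>M7\<^esub> = (False, False)"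
  "p \<oplus>\<^bsub>M7\<^esub> q = (fst p \<or> fst q, snd p \<or> snd q)"
  by (simp_all add: M7_def BB_monoid_def case_prod_unfold)

text \<open>
  The operators \<open>S\<close> and \<open>T\<close> only take the values zero and top, and the sum of two elements is
  one of them or top. Hence every subset with these two elements is a subsemimodule, which treats
  \<open>M7\<close>, \<open>M8\<close> and \<open>M9\<close> at once.
\<close>

lemma semimodule_M7_restrict:
  assumes H: "{(False, False), (True, True)} \<subseteq> H"
  shows "semimodule KL_S3 (M7\<lparr>carrier := H\<rparr>)"
proof (rule subsemimodule[OF semimodule_M7])
  interpret M7: semimodule KL_S3 M7 by (rule semimodule_M7)
  show add: "x \<oplus>\<^bsub>M7\<^esub> y \<in> H" if "x \<in> H" "y \<in> H" for x y
  proof -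
    have "x \<oplus>\<^bsub>M7\<^esub> y \<in> {x, y, (True, True)}"
      by (cases x; cases y) auto
    then show ?thesis using H that by auto
  qed
  show "r \<odot>\<^bsub>M7\<^esub> x \<in> H" if "r \<in> carrier KL_S3" "x \<in> H" for r x
    using that
  proof (induction r arbitrary: x rule: KL_S3_induct)
    case (s x)
    then show ?case using H by (cases "fst x") (auto simp: M7_basis)
  next
    case (t x)
    then show ?case using H by (cases "snd x") (auto simp: M7_basis)
  qed (use H add in \<open>auto simp: M7.smult_l_null M7.smult_one M7.smult_l_distr M7.smult_assoc
      M7_basis simp del: M7_simps(3)\<close>)
qed (use H in auto)

text \<open>
  Two distinct elements differ in the first or in the second component; applying \<open>S\<close> in the first
  case and \<open>T\<close> in the second yields zero and top.
\<close>

lemma elementary_proper_M7_restrict: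
  assumes H: "{(False, False), (True, True)} \<subseteq> H"
  shows "elementary_semimodule KL_S3 (M7\<lparr>carrier := H\<rparr>) \<and> proper_semimodule KL_S3 (M7\<lparr>carrier := H\<rparr>)"
proof (rule elementary_proper_if_absorbing[OF semimodule_M7_restrict[OF H], of "(True, True)"])
  fix \<rho> x y
  assume \<rho>: "semimodule_congruence KL_S3 (M7\<lparr>carrier := H\<rparr>) \<rho>" and xy: "(x, y) \<in> \<rho>" "x \<noteq> y"
  have sym: "sym \<rho>"
    using \<rho> by (auto simp: semimodule_congruence_def equiv_def)
  have "(kl_basis w \<odot>\<^bsub>M7\<^esub> x, kl_basis w \<odot>\<^bsub>M7\<^esub> y) \<in> \<rho>" if "w \<in> carrier S3" for w
    using \<rho> xy KL_S3_basis_closed[OF that] by (auto simp: semimodule_congruence_def)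
  from this[of S3_s] this[of S3_t]
  have "((fst x, fst x), (fst y, fst y)) \<in> \<rho>" "((snd x, snd x), (snd y, snd y)) \<in> \<rho>"
    by (simp_all add: M7_basis)
  moreover have "fst x \<noteq> fst y \<or> snd x \<noteq> snd y"
    using xy by (auto simp: prod_eq_iff)
  ultimately have "((False, False), (True, True)) \<in> \<rho>"
    using symD[OF sym] by (cases "fst x"; cases "fst y"; cases "snd x"; cases "snd y") auto
  then show "(\<zero>\<^bsub>M7\<lparr>carrier := H\<rparr>\<^esub>, (True, True)) \<in> \<rho>" by simp
qed (use H in auto)

lemma M7_restrict_UNIV: "M7\<lparr>carrier := UNIV\<rparr> = M7"
  by (simp add: M7_def kl_semimodule_def BB_monoid_def)

section \<open>Consequences of elementarity\<close>

text \<open>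
  Elements are compared up to multiples in the algebraic preorder: \<open>below x y\<close> means that \<open>x\<close> divides
  some multiple of \<open>y\<close> additively. Mutual comparability is a congruence that relates \<open>x\<close> to \<open>x + x\<close>;
  when it is full, \<open>x\<close> divides a multiple of zero, so it has an inverse.
\<close>

lemma elementary_group_or_idempotent:
  fixes M (structure)
  assumes M: "elementary_semimodule R M"
  shows "abelian_group M \<or> (\<forall>x\<in>carrier M. x \<oplus> x = x)"
proof -
  interpret semimodule R M
    using M by (simp add: elementary_semimodule_def)
  define below where "below x y \<longleftrightarrow> (\<exists>n::nat. \<exists>c\<in>carrier M. x \<oplus> c = [n] \<cdot> y)" for x y
  have below_trans: "below x z" if "below x y" "below y z" "x \<in> carrier M" "y \<in> carrier M" "z \<in> carrier M" for x y z
  proof -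
    obtain k l :: nat and c d where k: "x \<oplus> c = [k] \<cdot> y" "c \<in> carrier M"
      and l: "y \<oplus> d = [l] \<cdot> z" "d \<in> carrier M"
      using \<open>below x y\<close> \<open>below y z\<close> unfolding below_def by blast
    have "x \<oplus> (c \<oplus> [k] \<cdot> d) = [k] \<cdot> y \<oplus> [k] \<cdot> d"
      using k l that by (simp flip: M.a_assoc)
    also have "\<dots> = [k] \<cdot> ([l] \<cdot> z)"
      using that l by (simp add: M.add.nat_pow_distrib flip: l(1))
    also have "\<dots> = [(l * k)] \<cdot> z"
      using that by (simp add: M.add.nat_pow_pow)
    finally show ?thesis
      using k l unfolding below_def by blast
  qed
  have below_add: "below (x \<oplus> m) (y \<oplus> m)" if "below x y" "x \<in> carrier M" "y \<in> carrier M" "m \<in> carrier M" for x y m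
  proof -
    obtain k :: nat and c where k: "x \<oplus> c = [k] \<cdot> y" "c \<in> carrier M"
      using \<open>below x y\<close> unfolding below_def by blast
    have "(x \<oplus> m) \<oplus> (c \<oplus> ([k] \<cdot> m \<oplus> y)) = (x \<oplus> c) \<oplus> ([k] \<cdot> m \<oplus> (y \<oplus> m))"
      using k(2) that by (simp add: M.a_ac)
    also have "\<dots> = [Suc k] \<cdot> (y \<oplus> m)"
      unfolding k(1) using that by (simp add: M.add.nat_pow_distrib M.a_ac)
    finally show ?thesis
      using k that unfolding below_def by blast
  qed
  have smult_pow: "r \<odot> ([n] \<cdot> x) = [n] \<cdot> (r \<odot> x)" if "r \<in> carrier R" "x \<in> carrier M" for r x and n :: nat
    using that by (induction n) (simp_all add: smult_r_null smult_r_distr)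
  have below_smult: "below (r \<odot> x) (r \<odot> y)" if "below x y" "r \<in> carrier R" "x \<in> carrier M" "y \<in> carrier M" for r x y
  proof -
    obtain k :: nat and c where k: "x \<oplus> c = [k] \<cdot> y" "c \<in> carrier M"
      using \<open>below x y\<close> unfolding below_def by blast
    have "r \<odot> x \<oplus> r \<odot> c = [k] \<cdot> (r \<odot> y)"
      using k that by (simp add: smult_pow flip: smult_r_distr)
    then show ?thesis
      using k that unfolding below_def by blast
  qed
  have below_pow: "below x ([n] \<cdot> x)" "below ([n] \<cdot> x) x" if "x \<in> carrier M" "n > 0" for x and n :: nat
  proof -
    obtain k where n: "n = Suc k" using \<open>n > 0\<close> by (cases n) auto
    have "x \<oplus> [k] \<cdot> x = [(1::nat)] \<cdot> ([n] \<cdot> x)" "[n] \<cdot> x \<oplus> \<zero> = [n] \<cdot> x"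
      using that(1) by (simp_all add: n One_nat_def M.a_comm)
    then show "below x ([n] \<cdot> x)" "below ([n] \<cdot> x) x"
      using that unfolding below_def by (blast intro: M.add.nat_pow_closed)+
  qed
  define \<rho> where "\<rho> = {(x, y). x \<in> carrier M \<and> y \<in> carrier M \<and> below x y \<and> below y x}"
  have "equiv (carrier M) \<rho>"
  proof (rule equivI)
    show "refl_on (carrier M) \<rho>"
      using below_pow[of _ 1] by (auto simp: refl_on_def \<rho>_def One_nat_def)
    show "sym \<rho>" by (auto simp: sym_def \<rho>_def)
    show "trans \<rho>" unfolding trans_def \<rho>_def using below_trans by blast
  qed (auto simp: \<rho>_def)
  then have "semimodule_congruence R M \<rho>"
    by (auto simp: semimodule_congruence_def \<rho>_def below_add below_smult)
  then consider "\<rho> = Id_on (carrier M)" | "\<rho> = carrier M \<times> carrier M"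
    using M by (auto simp: elementary_semimodule_def)
  then show ?thesis
  proof cases
    case 1
    have "x \<oplus> x = x" if "x \<in> carrier M" for x
    proof -
      have "(x, x \<oplus> x) \<in> \<rho>"
        using below_pow[of x 2] that by (simp add: \<rho>_def numeral_2_eq_2)
      then show ?thesis using 1 by auto
    qed
    then show ?thesis by blast
  next
    case 2
    have "\<exists>c\<in>carrier M. c \<oplus> x = \<zero>" if "x \<in> carrier M" for x
    proof -
      have "below x \<zero>" using 2 that by (auto simp: \<rho>_def)
      then obtain n :: nat and c where "c \<in> carrier M" "x \<oplus> c = [n] \<cdot> \<zero>"
        unfolding below_def by blast
      then show ?thesis using that by (auto simp: M.a_comm)
    qed
    then have "abelian_group M"
      by (intro abelian_groupI) (auto intro: M.a_assoc M.a_comm)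
    then show ?thesis ..
  qed
qed

text \<open>
  The form in which elementarity is applied below: the only congruences are equality and the full
  relation, so a map whose kernel is a congruence is injective or constant. Because the equality of
  \<open>f\<close>-values passes to sums, compatibility with the generators suffices.
\<close>

lemma elementary_kernel_dichotomy:
  fixes M (structure)
  assumes M: "elementary_semimodule KL_S3 M"
    and add: "\<And>x y k. \<lbrakk>x \<in> carrier M; y \<in> carrier M; k \<in> carrier M; f x = f y\<rbrakk> \<Longrightarrow> f (x \<oplus> k) = f (y \<oplus> k)"
    and act: "\<And>w x y. \<lbrakk>w \<in> {S3_s, S3_t, S3_w0}; x \<in> carrier M; y \<in> carrier M; f x = f y\<rbrakk>
      \<Longrightarrow> f (kl_basis w \<odot> x) = f (kl_basis w \<odot> y)"
  shows "inj_on f (carrier M) \<or> (\<forall>x\<in>carrier M. f x = f \<zero>)"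
proof -
  interpret semimodule KL_S3 M
    using M by (simp add: elementary_semimodule_def)
  define \<rho> where "\<rho> = {(x, y). x \<in> carrier M \<and> y \<in> carrier M \<and> f x = f y}"
  have smult: "f (r \<odot> x) = f (r \<odot> y)"
    if "r \<in> carrier KL_S3" "x \<in> carrier M" "y \<in> carrier M" "f x = f y" for r x y
    using that
  proof (induction r arbitrary: x y rule: KL_S3_induct)
    case (add a b)
    have "f (a \<odot> x \<oplus> b \<odot> x) = f (a \<odot> y \<oplus> b \<odot> x)"
      using add.hyps add.prems by (intro assms(2) add.IH) auto
    also have "\<dots> = f (b \<odot> x \<oplus> a \<odot> y)"
      using add.hyps add.prems by (simp add: M.a_comm)
    also have "\<dots> = f (b \<odot> y \<oplus> a \<odot> y)"
      using add.hyps add.prems by (intro assms(2) add.IH) auto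
    also have "\<dots> = f (a \<odot> y \<oplus> b \<odot> y)"
      using add.hyps add.prems by (simp add: M.a_comm)
    finally show ?case
      using add.hyps add.prems by (simp add: smult_l_distr)
  next
    case (mult a b)
    have "f (a \<odot> (b \<odot> x)) = f (a \<odot> (b \<odot> y))"
      using mult.hyps mult.prems by (intro mult.IH) auto
    then show ?case using mult.hyps mult.prems by (simp add: smult_assoc)
  qed (simp_all add: smult_l_null smult_one, (rule act; simp)+)
  have "equiv (carrier M) \<rho>"
    by (rule equivI) (auto simp: \<rho>_def refl_on_def sym_def trans_def)
  then have "semimodule_congruence KL_S3 M \<rho>"
    by (auto simp: semimodule_congruence_def \<rho>_def intro: smult add)
  then consider "\<rho> = Id_on (carrier M)" | "\<rho> = carrier M \<times> carrier M"
    using M by (auto simp: elementary_semimodule_def)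
  then show ?thesis
  proof cases
    case 1
    have "inj_on f (carrier M)"
    proof (rule inj_onI)
      fix x y assume "x \<in> carrier M" "y \<in> carrier M" "f x = f y"
      then have "(x, y) \<in> \<rho>" by (simp add: \<rho>_def)
      then show "x = y" using 1 by auto
    qed
    then show ?thesis ..
  next
    case 2
    have "f x = f \<zero>" if "x \<in> carrier M" for x
    proof -
      have "(x, \<zero>) \<in> \<rho>" using 2 that by simp
      then show ?thesis by (simp add: \<rho>_def)
    qed
    then show ?thesis by blast
  qed
qed

lemma isomorphic_KL_S3I:
  fixes M (structure)
  assumes M: "semimodule KL_S3 M" and N: "semimodule KL_S3 N"
    and bij: "bij_betw h (carrier M) (carrier N)" and zero: "h \<zero> = \<zero>\<^bsub>N\<^esub>"
    and add: "\<And>x y. \<lbrakk>x \<in> carrier M; y \<in> carrier M\<rbrakk> \<Longrightarrow> h (x \<oplus> y) = h x \<oplus>\<^bsub>N\<^esub> h y"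
    and act: "\<And>x. x \<in> carrier M \<Longrightarrow> h (kl_basis S3_s \<odot> x) = kl_basis S3_s \<odot>\<^bsub>N\<^esub> h x"
      "\<And>x. x \<in> carrier M \<Longrightarrow> h (kl_basis S3_t \<odot> x) = kl_basis S3_t \<odot>\<^bsub>N\<^esub> h x"
      "\<And>x. x \<in> carrier M \<Longrightarrow> h (kl_basis S3_w0 \<odot> x) = kl_basis S3_w0 \<odot>\<^bsub>N\<^esub> h x"
  shows "isomorphic_semimodules KL_S3 M N"
proof -
  interpret M: semimodule KL_S3 M by fact
  interpret N: semimodule KL_S3 N by fact
  have h: "h x \<in> carrier N" if "x \<in> carrier M" for x
    using bij that by (auto simp: bij_betw_def)
  have "h (r \<odot> x) = r \<odot>\<^bsub>N\<^esub> h x" if "r \<in> carrier KL_S3" "x \<in> carrier M" for r x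
    using that
    by (induction r arbitrary: x rule: KL_S3_induct)
      (simp_all add: h zero add act M.smult_l_null N.smult_l_null M.smult_one N.smult_one
        M.smult_l_distr N.smult_l_distr M.smult_assoc N.smult_assoc)
  then have "h \<in> semimodule_iso KL_S3 M N"
    using bij h add zero by (auto simp: semimodule_iso_def iso_def hom_def)
  then show ?thesis
    by (auto simp: isomorphic_semimodules_def)
qed

section \<open>The classification\<close>

lemma elementary_proper_classification:
  fixes M :: "((nat \<Rightarrow> nat) \<Rightarrow> int, 'm) module" (structure)
  assumes el: "elementary_semimodule KL_S3 M" and proper: "proper_semimodule KL_S3 M"
  shows "isomorphic_semimodules KL_S3 M M1 \<or>
    isomorphic_semimodules KL_S3 M M2 \<or>
    isomorphic_semimodules KL_S3 M M3 \<or>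
    isomorphic_semimodules KL_S3 M M7 \<or>
    isomorphic_semimodules KL_S3 M M8 \<or>
    isomorphic_semimodules KL_S3 M M9"
proof -
  have M: "semimodule KL_S3 M" and ne: "carrier M \<noteq> {\<zero>}"
    using el by (auto simp: elementary_semimodule_def)
  interpret semimodule KL_S3 M by (rule M)
  have idem: "x \<oplus> x = x" if "x \<in> carrier M" for x
    using elementary_group_or_idempotent[OF el] proper that by (auto simp: proper_semimodule_def)
  have idem': "x \<oplus> (x \<oplus> y) = x \<oplus> y" if "x \<in> carrier M" "y \<in> carrier M" for x y
    using that by (simp add: idem flip: M.a_assoc)
  \<comment> \<open>zero is the least element of the semilattice, so a sum vanishes only if both summands do\<close>
  have add_eq_0: "x \<oplus> y = \<zero> \<longleftrightarrow> x = \<zero> \<and> y = \<zero>" if "x \<in> carrier M" "y \<in> carrier M" for x y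
    by (metis idem' that M.r_zero M.l_zero)
  obtain a where a: "a \<in> carrier M" "a \<noteq> \<zero>"
    using ne M.zero_closed by blast
  define S where "S x = kl_basis S3_s \<odot> x" for x
  define T where "T x = kl_basis S3_t \<odot> x" for x
  define W where "W x = kl_basis S3_w0 \<odot> x" for x
  note act_defs = S_def T_def W_def
  note closed [simp] = KL_S3_basis_closed[OF S3_mem(2)] KL_S3_basis_closed[OF S3_mem(3)]
    KL_S3_basis_closed[OF S3_mem(4)] KL_S3_basis_closed[OF S3_mem(5)] KL_S3_basis_closed[OF S3_mem(6)]
  have STW [simp]: "S x \<in> carrier M" "T x \<in> carrier M" "W x \<in> carrier M" if "x \<in> carrier M" for x
    using that by (simp_all add: act_defs)
  have zero [simp]: "S \<zero> = \<zero>" "T \<zero> = \<zero>" "W \<zero> = \<zero>"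
    by (simp_all add: act_defs smult_r_null)
  have add: "S (x \<oplus> y) = S x \<oplus> S y" "T (x \<oplus> y) = T x \<oplus> T y" "W (x \<oplus> y) = W x \<oplus> W y"
    if "x \<in> carrier M" "y \<in> carrier M" for x y
    using that by (simp_all add: act_defs smult_r_distr)
  have rel: "S (S x) = S x" "T (T x) = T x" "S (W x) = W x" "T (W x) = W x" "W (S x) = W x"
    "W (T x) = W x" "W (W x) = W x" "S (T (S x)) = W x \<oplus> S x" "T (S (T x)) = W x \<oplus> T x"
    if "x \<in> carrier M" for x
    unfolding act_defs using that
    by (simp_all add: KL_S3_basis_mult smult_l_distr idem flip: smult_assoc)
  have dichotomy: "inj_on f (carrier M) \<or> (\<forall>x\<in>carrier M. f x = f \<zero>)"
    if "\<And>x y k. \<lbrakk>x \<in> carrier M; y \<in> carrier M; k \<in> carrier M; f x = f y\<rbrakk> \<Longrightarrow> f (x \<oplus> k) = f (y \<oplus> k)"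
      "\<And>x y. \<lbrakk>x \<in> carrier M; y \<in> carrier M; f x = f y\<rbrakk> \<Longrightarrow> f (S x) = f (S y)"
      "\<And>x y. \<lbrakk>x \<in> carrier M; y \<in> carrier M; f x = f y\<rbrakk> \<Longrightarrow> f (T x) = f (T y)"
      "\<And>x y. \<lbrakk>x \<in> carrier M; y \<in> carrier M; f x = f y\<rbrakk> \<Longrightarrow> f (W x) = f (W y)" for f :: "'m \<Rightarrow> 'c"
  proof (rule elementary_kernel_dichotomy[OF el])
    fix w x y assume "w \<in> {S3_s, S3_t, S3_w0}" and xy: "x \<in> carrier M" "y \<in> carrier M" "f x = f y"
    then consider "w = S3_s" | "w = S3_t" | "w = S3_w0" by blast
    then show "f (kl_basis w \<odot> x) = f (kl_basis w \<odot> y)"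
      using that(2-4)[OF xy] by cases (simp_all only: act_defs)
  qed (rule that(1))
  have iso: "isomorphic_semimodules KL_S3 M N"
    if "semimodule KL_S3 N" "bij_betw h (carrier M) (carrier N)" "h \<zero> = \<zero>\<^bsub>N\<^esub>"
      "\<And>x y. \<lbrakk>x \<in> carrier M; y \<in> carrier M\<rbrakk> \<Longrightarrow> h (x \<oplus> y) = h x \<oplus>\<^bsub>N\<^esub> h y"
      "\<And>x. x \<in> carrier M \<Longrightarrow> h (S x) = kl_basis S3_s \<odot>\<^bsub>N\<^esub> h x"
      "\<And>x. x \<in> carrier M \<Longrightarrow> h (T x) = kl_basis S3_t \<odot>\<^bsub>N\<^esub> h x"
      "\<And>x. x \<in> carrier M \<Longrightarrow> h (W x) = kl_basis S3_w0 \<odot>\<^bsub>N\<^esub> h x"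
    for N :: "((nat \<Rightarrow> nat) \<Rightarrow> int, 'c, 'd) module_scheme" and h
    using that by (intro isomorphic_KL_S3I[OF M, of N h]) (simp_all add: act_defs)
  have bij_bool: "bij_betw (\<lambda>x. x \<noteq> \<zero>) (carrier M) UNIV"
    if "inj_on (\<lambda>x. x = \<zero>) (carrier M)"
  proof -
    have "(\<lambda>x. x \<noteq> \<zero>) ` carrier M = UNIV"
      using a M.zero_closed by (auto simp: UNIV_bool image_iff)
    moreover have "inj_on (\<lambda>x. x \<noteq> \<zero>) (carrier M)"
      using that by (auto simp: inj_on_def)
    ultimately show ?thesis by (simp add: bij_betw_def)
  qed
  have W_cases: "inj_on W (carrier M) \<or> (\<forall>x\<in>carrier M. W x = \<zero>)"
  proof -
    have "inj_on W (carrier M) \<or> (\<forall>x\<in>carrier M. W x = W \<zero>)"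
      by (rule dichotomy) (simp_all add: add rel)
    then show ?thesis by simp
  qed
  show ?thesis
  proof (cases "inj_on W (carrier M)")
    case True
    have triv: "S x = x" "T x = x" "W x = x" if "x \<in> carrier M" for x
      by (rule inj_onD[OF True]; simp add: that rel)+
    have "inj_on (\<lambda>x. x = \<zero>) (carrier M) \<or> (\<forall>x\<in>carrier M. (x = \<zero>) = (\<zero> = \<zero>))"
      by (rule dichotomy) (simp_all add: add_eq_0 triv)
    then have "inj_on (\<lambda>x. x = \<zero>) (carrier M)"
      using a by auto
    then have "isomorphic_semimodules KL_S3 M M1"
      by (intro iso[of M1 "\<lambda>x. x \<noteq> \<zero>"])
        (use bij_bool in \<open>auto simp: semimodule_M1 M1_basis triv add_eq_0, auto simp: M1_def B_monoid_def\<close>)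
    then show ?thesis by blast
  next
    case False
    then have W0: "W x = \<zero>" if "x \<in> carrier M" for x
      using W_cases that by blast
    have ST_cases: "inj_on (\<lambda>x. (S x, T x)) (carrier M) \<or> (\<forall>x\<in>carrier M. S x = \<zero> \<and> T x = \<zero>)"
    proof -
      have "inj_on (\<lambda>x. (S x, T x)) (carrier M) \<or> (\<forall>x\<in>carrier M. (S x, T x) = (S \<zero>, T \<zero>))"
        by (rule dichotomy) (simp_all add: add rel W0)
      then show ?thesis by simp
    qed
    show ?thesis
    proof (cases "inj_on (\<lambda>x. (S x, T x)) (carrier M)")
      case False
      then have ST0: "S x = \<zero>" "T x = \<zero>" if "x \<in> carrier M" for x
        using ST_cases that by blast+
      have "inj_on (\<lambda>x. x = \<zero>) (carrier M) \<or> (\<forall>x\<in>carrier M. (x = \<zero>) = (\<zero> = \<zero>))"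
        by (rule dichotomy) (simp_all add: add_eq_0 ST0 W0)
      then have "inj_on (\<lambda>x. x = \<zero>) (carrier M)"
        using a by auto
      then have "isomorphic_semimodules KL_S3 M M2"
        by (intro iso[of M2 "\<lambda>x. x \<noteq> \<zero>"])
          (use bij_bool in \<open>auto simp: semimodule_M2 M2_basis ST0 W0 add_eq_0 S3_distinct_simps,
            auto simp: M2_def B_monoid_def\<close>)
      then show ?thesis by blast
    next
      case True
      \<comment> \<open>\<open>S\<close> and \<open>T\<close> take the same values on both sides, since \<open>STS = S\<close> and \<open>TST = T\<close>\<close>
      have TS: "T (S x) = S x" "S (T x) = T x" if "x \<in> carrier M" for x
        by (rule inj_onD[OF True]; simp add: that rel W0)+
      define h where "h x = (S x \<noteq> \<zero>, T x \<noteq> \<zero>)" for x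
      have h_add: "h (x \<oplus> y) = h x \<oplus>\<^bsub>M7\<^esub> h y" if "x \<in> carrier M" "y \<in> carrier M" for x y
        using that by (auto simp: h_def add add_eq_0)
      have h_act: "h (S x) = (fst (h x), fst (h x))" "h (T x) = (snd (h x), snd (h x))"
        "h (W x) = (False, False)" if "x \<in> carrier M" for x
        using that by (simp_all add: h_def rel TS W0)
      have "S a \<noteq> \<zero> \<or> T a \<noteq> \<zero>"
        using a inj_onD[OF True, of a \<zero>] by auto
      then have ha: "h a \<noteq> h \<zero>" by (auto simp: h_def)
      have inj: "inj_on h (carrier M)"
      proof -
        have "inj_on h (carrier M) \<or> (\<forall>x\<in>carrier M. h x = h \<zero>)"
          by (rule dichotomy) (simp_all only: h_add h_act)
        then show ?thesis using a ha by auto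
      qed
      define H where "H = h ` carrier M"
      have h0: "h \<zero> = (False, False)" by (simp add: h_def)
      \<comment> \<open>the top element is the value of \<open>h\<close> at \<open>S a\<close> or at \<open>T a\<close>\<close>
      have "(True, True) \<in> H"
        using ha h0 h_act(1)[OF a(1)] h_act(2)[OF a(1)] a(1) unfolding H_def
        by (cases "h a") (metis (full_types) STW(1,2) fst_conv snd_conv image_eqI)
      moreover have "(False, False) \<in> H"
        using h0 unfolding H_def by (metis M.zero_closed image_eqI)
      ultimately have H: "{(False, False), (True, True)} \<subseteq> H" by simp
      have bij: "bij_betw h (carrier M) H"
        using inj by (simp add: H_def bij_betw_def)
      have iso_H: "isomorphic_semimodules KL_S3 M (M7\<lparr>carrier := H\<rparr>)"
        by (rule iso[of _ h])
          (simp_all add: semimodule_M7_restrict[OF H] bij h0 h_add h_act M7_basis del: M7_simps(3))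
      have "H = UNIV \<or> H = {(False, False), (True, False), (True, True)} \<or>
          H = {(False, False), (False, True), (True, True)} \<or> H = {(False, False), (True, True)}"
        using H by (cases "(True, False) \<in> H"; cases "(False, True) \<in> H") (auto simp: set_eq_iff; metis (full_types))+
      then consider "M7\<lparr>carrier := H\<rparr> = M7" | "M7\<lparr>carrier := H\<rparr> = M8" | "M7\<lparr>carrier := H\<rparr> = M9"
        | "H = {(False, False), (True, True)}"
        using M7_restrict_UNIV by (auto simp: M8_def M9_def)
      then show ?thesis
      proof cases
        case 4
        \<comment> \<open>the image is the diagonal, on which \<open>S\<close> and \<open>T\<close> act as the identity\<close>
        have h_diag: "snd (h x) = fst (h x)" if "x \<in> carrier M" for x
        proof -
          have "h x \<in> H" using that by (simp add: H_def)
          then show ?thesis unfolding 4 by auto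
        qed
        have "bij_betw fst H UNIV"
          by (auto simp: 4 bij_betw_def UNIV_bool)
        then have "bij_betw (fst \<circ> h) (carrier M) UNIV"
          by (rule bij_betw_trans[OF bij])
        then have "isomorphic_semimodules KL_S3 M M3"
          by (intro iso[of M3 "fst \<circ> h"])
            (auto simp: semimodule_M3 M3_basis h0 h_add h_act h_diag S3_distinct_simps,
              auto simp: M3_def B_monoid_def)
        then show ?thesis by blast
      qed (use iso_H in auto)
    qed
  qed
qed

theorem theorem8p5:
  fixes M :: "((nat \<Rightarrow> nat) \<Rightarrow> int, 'm) module"
  shows "((elementary_semimodule KL_S3 M1 \<and> proper_semimodule KL_S3 M1) \<and>
      (elementary_semimodule KL_S3 M2 \<and> proper_semimodule KL_S3 M2) \<and>
      (elementary_semimodule KL_S3 M3 \<and> proper_semimodule KL_S3 M3) \<and>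
      (elementary_semimodule KL_S3 M7 \<and> proper_semimodule KL_S3 M7) \<and>
      (elementary_semimodule KL_S3 M8 \<and> proper_semimodule KL_S3 M8) \<and>
      (elementary_semimodule KL_S3 M9 \<and> proper_semimodule KL_S3 M9)) \<and>
    (elementary_semimodule KL_S3 M \<and> proper_semimodule KL_S3 M \<longrightarrow>
      isomorphic_semimodules KL_S3 M M1 \<or>
      isomorphic_semimodules KL_S3 M M2 \<or>
      isomorphic_semimodules KL_S3 M M3 \<or>
      isomorphic_semimodules KL_S3 M M7 \<or>
      isomorphic_semimodules KL_S3 M M8 \<or>
      isomorphic_semimodules KL_S3 M M9)"
proof -
  have "elementary_semimodule KL_S3 M1 \<and> proper_semimodule KL_S3 M1"
    "elementary_semimodule KL_S3 M2 \<and> proper_semimodule KL_S3 M2"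
    "elementary_semimodule KL_S3 M3 \<and> proper_semimodule KL_S3 M3"
    using elementary_proper_B semimodule_M1 semimodule_M2 semimodule_M3
    unfolding M1_def M2_def M3_def by blast+
  moreover have "elementary_semimodule KL_S3 M7 \<and> proper_semimodule KL_S3 M7"
    "elementary_semimodule KL_S3 M8 \<and> proper_semimodule KL_S3 M8"
    "elementary_semimodule KL_S3 M9 \<and> proper_semimodule KL_S3 M9"
    using elementary_proper_M7_restrict[of UNIV] elementary_proper_M7_restrict
    by (simp_all add: M7_restrict_UNIV M8_def M9_def)
  ultimately show ?thesis
    using elementary_proper_classification by blast
qed

end
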